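(* Let $x_{ab},y_{ab}$ ($1\le a,b\le n$) be independent commuting variables, and let $Z,D$ be the $n\times n$ matrices with entries $Z_{ab}=x_{ab}+iy_{ab}$ and $D_{ab}=\tfrac12\big(\tfrac{\partial}{\partial x_{ab}}-i\tfrac{\partial}{\partial y_{ab}}\big)$. Let $Z^{\mathbb R}$ be the $2n\times 2n$ matrix whose $(a,b)$-th $2\times 2$ block is $\begin{pmatrix}x_{ab}&y_{ab}\\-y_{ab}&x_{ab}\end{pmatrix}$ and let $(D^t)^{\mathbb R}$ be the $2n\times2n$ matrix whose $(a,b)$-th $2\times2$ block is $\tfrac12\begin{pmatrix}\partial/\partial x_{ba}&-\partial/\partial y_{ba}\\ \partial/\partial y_{ba}&\partial/\partial x_{ba}\end{pmatrix}$. Let $T$ be the $2n\times 2n$ block-diagonal matrix whose $m$-th diagonal $2\times2$ block is $$\begin{pmatrix} n-m+\tfrac14 & \tfrac{i}{4}\\ \tfrac{i}{4} & n-m-\tfrac14\end{pmatrix},\qquad m=1,\dots,n .$$ Then, in the algebra of polynomial-coefficient differential operators on $\mathbb C[x_{ab},y_{ab}]$, $${\det}^{\mathrm{col}}\big(Z^{\mathbb R}(D^t)^{\mathbb R}+T\big)={\det}^{\mathrm{col}}\big(Z^{\mathbb R}\big)\,{\det}^{\mathrm{col}}\big((D^t)^{\mathbb R}\big).$$ The same identity holds with $T$ replaced by its complex conjugate (i.e. $i$ replaced by $-i$ in $T$).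
   Context: The matrices $Z^{\mathbb R}$ and $(D^t)^{\mathbb R}$ are the real forms ("decomplexifications") of $Z$ and of the transpose $D^t$: each entry $c=\mathrm{Re}(c)+i\,\mathrm{Im}(c)$ is replaced by the block $\begin{pmatrix}\mathrm{Re}(c)&\mathrm{Im}(c)\\-\mathrm{Im}(c)&\mathrm{Re}(c)\end{pmatrix}$, where $x_{ab},y_{ab},\partial/\partial x_{ab},\partial/\partial y_{ab}$ are regarded as real. The column-determinant of an $N\times N$ matrix $M$ over a not necessarily commutative ring is ${\det}^{\mathrm{col}}M=\sum_{\sigma\in S_N}\mathrm{sgn}(\sigma)\,M_{\sigma(1)1}M_{\sigma(2)2}\cdots M_{\sigma(N)N}$ (factors ordered by column); it is the usual determinant when all entries commute. *)

theory Defs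
  imports "HOL-Library.Poly_Mapping" "Jordan_Normal_Form.Matrix"
    "HOL-Combinatorics.Permutations" Complex_Main
begin

section \<open>Complex polynomials in a family of commuting variables\<close>

text \<open>
  An element of \<open>'v cpoly\<close> is a finitely supported family of complex coefficients indexed by
  monomials, a monomial being a finitely supported exponent vector \<open>'v \<Rightarrow>\<^sub>0 nat\<close>. The ring
  structure (convolution product) is the one of \<open>Poly_Mapping\<close>.
\<close>

type_synonym 'v cpoly = "('v \<Rightarrow>\<^sub>0 nat) \<Rightarrow>\<^sub>0 complex"

definition poly_const :: "complex \<Rightarrow> 'v cpoly" where
  "poly_const c = Poly_Mapping.single 0 c"

definition poly_var :: "'v \<Rightarrow> 'v cpoly" where
  "poly_var v = Poly_Mapping.single (Poly_Mapping.single v 1) 1"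

text \<open>
  Exponents are subtracted with truncation, but a monomial not containing \<open>v\<close> receives the
  coefficient 0, so the truncation is harmless.
\<close>

definition partial_deriv :: "'v \<Rightarrow> 'v cpoly \<Rightarrow> 'v cpoly" where
  "partial_deriv v p = (\<Sum>m \<in> Poly_Mapping.keys p.
     Poly_Mapping.single (m - Poly_Mapping.single v 1)
       (of_nat (Poly_Mapping.lookup m v) * Poly_Mapping.lookup p m))"

lemma lookup_partial_deriv:
  "Poly_Mapping.lookup (partial_deriv v p) m =
     of_nat (Poly_Mapping.lookup m v + 1) * Poly_Mapping.lookup p (m + Poly_Mapping.single v 1)"
proof -
  let ?e = "Poly_Mapping.single v (1::nat)"
  let ?c = "\<lambda>k. of_nat (Poly_Mapping.lookup k v) * Poly_Mapping.lookup p k"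
  have eq: "(?c k when k - ?e = m) = (if k = m + ?e then ?c k else 0)" for k
  proof (cases "Poly_Mapping.lookup k v = 0")
    case True
    then have "k \<noteq> m + ?e" by (auto simp: lookup_add)
    with True show ?thesis by (simp add: when_def)
  next
    case False
    have "k = (k - ?e) + ?e"
      by (rule poly_mapping_eqI) (use False in \<open>auto simp: lookup_add lookup_minus lookup_single when_def\<close>)
    then have "k - ?e = m \<longleftrightarrow> k = m + ?e" by (metis add_right_cancel)
    then show ?thesis by (simp add: when_def)
  qed
  have "Poly_Mapping.lookup (partial_deriv v p) m =
      (\<Sum>k \<in> Poly_Mapping.keys p. ?c k when k - ?e = m)"
    by (simp add: partial_deriv_def lookup_sum lookup_single)
  also have "\<dots> = (\<Sum>k \<in> Poly_Mapping.keys p. if k = m + ?e then ?c k else 0)"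
    by (simp only: eq)
  also have "\<dots> = ?c (m + ?e)"
    by (simp add: in_keys_iff)
  finally show ?thesis by (simp add: lookup_add)
qed

lemma partial_deriv_add: "partial_deriv v (p + q) = partial_deriv v p + partial_deriv v q"
  by (rule poly_mapping_eqI) (simp add: lookup_partial_deriv lookup_add algebra_simps)


section \<open>The algebra of polynomial-coefficient differential operators\<close>

inductive_set diff_ops :: "('v cpoly \<Rightarrow> 'v cpoly) set" where
  mult: "(\<lambda>f. p * f) \<in> diff_ops"
| deriv: "partial_deriv v \<in> diff_ops"
| add: "F \<in> diff_ops \<Longrightarrow> G \<in> diff_ops \<Longrightarrow> (\<lambda>f. F f + G f) \<in> diff_ops"
| comp: "F \<in> diff_ops \<Longrightarrow> G \<in> diff_ops \<Longrightarrow> F \<circ> G \<in> diff_ops"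

lemma diff_ops_additive: "F \<in> diff_ops \<Longrightarrow> F (f + g) = F f + F g"
  by (induction arbitrary: f g rule: diff_ops.induct)
    (auto simp: partial_deriv_add distrib_left ac_simps)

lemma diff_ops_zero [simp]: "(\<lambda>f :: 'v cpoly. 0) \<in> diff_ops"
proof -
  have "(*) 0 = (\<lambda>f :: 'v cpoly. 0 :: 'v cpoly)" by (simp add: fun_eq_iff)
  then show ?thesis using diff_ops.mult[of "0 :: 'v cpoly"] by simp
qed

lemma diff_ops_one [simp]: "(id :: 'v cpoly \<Rightarrow> 'v cpoly) \<in> diff_ops"
proof -
  have "(*) 1 = (id :: 'v cpoly \<Rightarrow> 'v cpoly)" by (simp add: fun_eq_iff)
  then show ?thesis using diff_ops.mult[of "1 :: 'v cpoly"] by simp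
qed

lemma diff_ops_uminus: "F \<in> diff_ops \<Longrightarrow> (\<lambda>f. - F f) \<in> diff_ops"
  using diff_ops.comp[OF diff_ops.mult[of "- 1"]] by (auto simp: comp_def)

lemma diff_ops_diff: "F \<in> diff_ops \<Longrightarrow> G \<in> diff_ops \<Longrightarrow> (\<lambda>f. F f - G f) \<in> diff_ops"
  using diff_ops.add[OF _ diff_ops_uminus] by fastforce

typedef 'v diff_op = "diff_ops :: ('v cpoly \<Rightarrow> 'v cpoly) set"
  morphisms apply_op Abs_diff_op
  using diff_ops_one by blast

setup_lifting type_definition_diff_op

instantiation diff_op :: (type) ring_1
begin

lift_definition zero_diff_op :: "'v diff_op" is "\<lambda>f. 0" by simp
lift_definition one_diff_op :: "'v diff_op" is id by simp
lift_definition plus_diff_op :: "'v diff_op \<Rightarrow> 'v diff_op \<Rightarrow> 'v diff_op"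
  is "\<lambda>F G f. F f + G f" by (rule diff_ops.add)
lift_definition uminus_diff_op :: "'v diff_op \<Rightarrow> 'v diff_op"
  is "\<lambda>F f. - F f" by (rule diff_ops_uminus)
lift_definition minus_diff_op :: "'v diff_op \<Rightarrow> 'v diff_op \<Rightarrow> 'v diff_op"
  is "\<lambda>F G f. F f - G f" by (rule diff_ops_diff)
lift_definition times_diff_op :: "'v diff_op \<Rightarrow> 'v diff_op \<Rightarrow> 'v diff_op"
  is "\<lambda>F G. F \<circ> G" by (rule diff_ops.comp)

instance
proof
  show "(0::'a diff_op) \<noteq> 1"
    by transfer (metis id_apply zero_neq_one)
qed (transfer; auto simp: fun_eq_iff diff_ops_additive)+

end

definition mult_op :: "'v cpoly \<Rightarrow> 'v diff_op" where
  "mult_op p = Abs_diff_op (\<lambda>f. p * f)"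

lemma apply_mult_op: "apply_op (mult_op p) f = p * f"
  by (simp add: mult_op_def Abs_diff_op_inverse diff_ops.mult)

lift_definition deriv_op :: "'v \<Rightarrow> 'v diff_op" is partial_deriv
  by (rule diff_ops.deriv)

definition var_op :: "'v \<Rightarrow> 'v diff_op" where
  "var_op v = mult_op (poly_var v)"

definition scalar_op :: "complex \<Rightarrow> 'v diff_op" where
  "scalar_op c = mult_op (poly_const c)"


section \<open>Column determinant and matrices made of 2-by-2 blocks\<close>

definition col_det :: "'a :: ring_1 mat \<Rightarrow> 'a" where
  "col_det M = (\<Sum>\<sigma> | \<sigma> permutes {0..<dim_col M}.
     of_int (sign \<sigma>) * prod_list (map (\<lambda>j. M $$ (\<sigma> j, j)) [0..<dim_col M]))"

text \<open>
  Blocks are numbered from 1 to \<open>n\<close>, whereas matrix entries are numbered from 0 to \<open>2 * n - 1\<close>.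
\<close>

definition block2_mat :: "nat \<Rightarrow> (nat \<Rightarrow> nat \<Rightarrow> 'a mat) \<Rightarrow> 'a mat" where
  "block2_mat n B = mat (2 * n) (2 * n)
     (\<lambda>(i, j). B (i div 2 + 1) (j div 2 + 1) $$ (i mod 2, j mod 2))"

text \<open>
  The real form of the \<open>n \<times> n\<close> matrix with \<open>(a, b)\<close>-th entry \<open>R a b + \<i> J a b\<close>, where \<open>R a b\<close>
  and \<open>J a b\<close> are regarded as real.
\<close>

definition real_form :: "nat \<Rightarrow> (nat \<Rightarrow> nat \<Rightarrow> 'a) \<Rightarrow> (nat \<Rightarrow> nat \<Rightarrow> 'a :: ring_1) \<Rightarrow> 'a mat" where
  "real_form n R J = block2_mat n (\<lambda>a b.
     mat_of_rows_list 2 [[  R a b, J a b],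
                         [- J a b, R a b]])"

definition Z_real :: "nat \<Rightarrow> (nat \<Rightarrow> nat \<Rightarrow> 'v) \<Rightarrow> (nat \<Rightarrow> nat \<Rightarrow> 'v) \<Rightarrow> 'v diff_op mat" where
  "Z_real n x y = real_form n (\<lambda>a b. var_op (x a b)) (\<lambda>a b. var_op (y a b))"

text \<open>Here \<open>D a b = 1/2 * (\<partial>/\<partial>x a b - \<i> \<partial>/\<partial>y a b)\<close>, and the indices are swapped by transposition.\<close>

definition Dt_real :: "nat \<Rightarrow> (nat \<Rightarrow> nat \<Rightarrow> 'v) \<Rightarrow> (nat \<Rightarrow> nat \<Rightarrow> 'v) \<Rightarrow> 'v diff_op mat" where
  "Dt_real n x y = real_form n
     (\<lambda>a b. scalar_op (1/2) * deriv_op (x b a))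
     (\<lambda>a b. - (scalar_op (1/2) * deriv_op (y b a)))"

definition T_mat :: "nat \<Rightarrow> complex mat" where
  "T_mat n = block2_mat n (\<lambda>m m'.
     if m = m' then
       mat_of_rows_list 2 [[of_nat n - of_nat m + 1/4, \<i>/4],
                           [\<i>/4, of_nat n - of_nat m - 1/4]]
     else 0\<^sub>m 2 2)"

end

theory Submission
  imports Defs
begin

text \<open>
  A column determinant is the coefficient of a product of Grassmann elements: if \<open>\<psi> 0, \<dots>, \<psi> (N - 1)\<close> anticommute,
  square to zero and commute with the entries of \<open>M\<close>, then the ordered product of the columns
  \<open>\<Sum>i. \<psi> i * M i j\<close> is \<open>\<psi> 0 * \<dots> * \<psi> (N - 1)\<close> times the column determinant of \<open>M\<close>
  (\<open>oprod_columns\<close>). Such variables exist over every ring of coefficients, and the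
  factor \<open>\<psi> 0 * \<dots> * \<psi> (N - 1)\<close> can be cancelled (\<open>oprod_create_cancel\<close>).

  Fix a square root \<open>I\<close> of \<open>-1\<close> and write the two variables of the \<open>a\<close>-th block in complex
  coordinates, \<open>\<theta> a = \<psi> (2 a) + I \<psi> (2 a + 1)\<close> and \<open>\<theta>' a = \<psi> (2 a) - I \<psi> (2 a + 1)\<close>. The two
  columns of the \<open>b\<close>-th block of the real form of \<open>\<Pi> = Z D\<^sup>t\<close> are then combinations of
  \<open>\<eta> b = \<Sum>a. \<theta> a * \<Pi> a b\<close> and of its conjugate \<open>\<eta>' b\<close>. Put \<open>H b = \<eta> b + (n - 1 - b) \<theta> b\<close>, and
  likewise \<open>H' b\<close>, for \<open>b = 0, \<dots>, n - 1\<close>. The entries of the correction \<open>T\<close> are such that the two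
  columns of \<open>Z\<^sup>\<real> (D\<^sup>t)\<^sup>\<real> + T\<close> multiply to \<open>I/2 * H b * H' b\<close> plus a multiple of \<open>H' b * H' b\<close>
  (\<open>two_columns\<close>). Each factor \<open>H' b\<close> has degree one in the \<open>n\<close> variables \<open>\<theta>'\<close>, so a product over
  all \<open>b\<close> that uses one of the terms \<open>H' b * H' b\<close> has degree more than \<open>n\<close> and is zero
  (\<open>oprod_drop_excess\<close>). What remains factors, up to a scalar, into the product of the \<open>H b\<close> and
  the product of the \<open>H' b\<close>.

  The classical Capelli identity evaluates each of these. With \<open>\<zeta> c = \<Sum>a. \<theta> a * Z a c\<close> one has
  \<open>H t b * \<zeta> d = - \<zeta> d * H (t - 1) b\<close>, where \<open>H t b = \<eta> b + t \<theta> b\<close>. Moving every \<open>\<zeta>\<close> to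
  the left therefore uses up exactly the shifts \<open>n - 1 - b\<close>, and the product of the \<open>H b\<close> is the
  normally ordered product of the \<open>\<zeta>\<close> and the entries of \<open>D\<close>, that is \<open>\<zeta> 0 * \<dots> * \<zeta> (n - 1)\<close>
  times the determinant of \<open>D\<^sup>t\<close> (\<open>capelli_identity\<close>). The same change of coordinates applied to
  \<open>Z\<^sup>\<real>\<close> and to \<open>(D\<^sup>t)\<^sup>\<real>\<close> alone, whose entries commute (\<open>rform_commuting\<close>), identifies the
  result with the right-hand side. Taking \<open>I = \<i>\<close> and \<open>I = - \<i>\<close> gives the two identities.
\<close>


section \<open>Ordered products in a noncommutative ring\<close>

text \<open>
  The two relations below are kept folded, so that sums and products of elements can be treated
  by introduction rules rather than by rewriting.
\<close>

definition comm :: "'a::ring_1 \<Rightarrow> 'a \<Rightarrow> bool" where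
  "comm a b \<longleftrightarrow> a * b = b * a"

definition acomm :: "'a::ring_1 \<Rightarrow> 'a \<Rightarrow> bool" where
  "acomm a b \<longleftrightarrow> a * b = - (b * a)"

lemma comm_sym: "comm a b \<Longrightarrow> comm b a"
  by (simp add: comm_def)

lemma acomm_sym: "acomm a b \<Longrightarrow> acomm b a"
  by (simp add: acomm_def)

lemma comm_0 [simp]: "comm a 0" "comm 0 a"
  and comm_1 [simp]: "comm a 1" "comm 1 a"
  by (simp_all add: comm_def)

lemma acomm_0 [simp]: "acomm a 0" "acomm 0 a"
  by (simp_all add: acomm_def)

lemma comm_add: "comm a b \<Longrightarrow> comm a c \<Longrightarrow> comm a (b + c)"
  by (simp add: comm_def algebra_simps)

lemma comm_uminus: "comm a b \<Longrightarrow> comm a (- b)"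
  by (simp add: comm_def)

lemma comm_diff: "comm a b \<Longrightarrow> comm a c \<Longrightarrow> comm a (b - c)"
  by (simp add: comm_def algebra_simps)

lemma comm_mult: "comm a b \<Longrightarrow> comm a c \<Longrightarrow> comm a (b * c)"
  unfolding comm_def by (metis mult.assoc)

lemma comm_mult_left: "comm a c \<Longrightarrow> comm b c \<Longrightarrow> comm (a * b) c"
  by (blast intro: comm_mult comm_sym)

lemma comm_sum: "(\<And>i. i \<in> S \<Longrightarrow> comm a (f i)) \<Longrightarrow> comm a (\<Sum>i\<in>S. f i)"
  by (simp add: comm_def sum_distrib_left sum_distrib_right)

lemma comm_of_int: "comm a (of_int k)"
  by (simp add: comm_def mult_of_int_commute)

lemma comm_prod_list: "(\<And>b. b \<in> set bs \<Longrightarrow> comm a b) \<Longrightarrow> comm a (prod_list bs)"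
  by (induction bs) (auto intro: comm_mult)

lemma acomm_add: "acomm a b \<Longrightarrow> acomm a c \<Longrightarrow> acomm a (b + c)"
  by (simp add: acomm_def algebra_simps)

lemma acomm_mult_comm: "acomm a b \<Longrightarrow> comm a c \<Longrightarrow> acomm a (b * c)"
  unfolding acomm_def comm_def by (metis mult.assoc mult_minus_left)

lemma acomm_comm_mult: "comm a c \<Longrightarrow> acomm a b \<Longrightarrow> acomm a (c * b)"
  unfolding acomm_def comm_def by (metis mult.assoc mult_minus_right)

lemma acomm_sum: "(\<And>i. i \<in> S \<Longrightarrow> acomm a (f i)) \<Longrightarrow> acomm a (\<Sum>i\<in>S. f i)"
  by (simp add: acomm_def sum_distrib_left sum_distrib_right sum_negf)

lemmas comm_intros = comm_add comm_uminus comm_diff comm_mult comm_sum comm_of_int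

text \<open>The product \<open>u 0 * u 1 * \<dots> * u (k - 1)\<close>, with factors in this order.\<close>

definition oprod :: "(nat \<Rightarrow> 'a::ring_1) \<Rightarrow> nat \<Rightarrow> 'a" where
  "oprod u k = prod_list (map u [0..<k])"

lemma oprod_0 [simp]: "oprod u 0 = 1"
  and oprod_Suc: "oprod u (Suc k) = oprod u k * u k"
  by (simp_all add: oprod_def)

lemma oprod_cong: "(\<And>i. i < k \<Longrightarrow> u i = v i) \<Longrightarrow> oprod u k = oprod v k"
  unfolding oprod_def by (intro arg_cong[of _ _ prod_list] map_cong) auto

lemma comm_oprod: "(\<And>i. i < k \<Longrightarrow> comm a (u i)) \<Longrightarrow> comm a (oprod u k)"
  unfolding oprod_def by (rule comm_prod_list) auto

lemma oprod_pairs: "oprod u (2 * k) = oprod (\<lambda>b. u (2 * b) * u (2 * b + 1)) k"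
  by (induction k) (simp_all add: oprod_Suc mult.assoc)

lemma minus_one_power_commute: "w * (- 1) ^ k = (- 1) ^ k * (w :: 'a::ring_1)"
  by (cases "even k") auto

lemma oprod_central:
  assumes "\<And>w. comm c w"
  shows "oprod (\<lambda>i. c * u i) k = c ^ k * oprod u k"
proof (induction k)
  case (Suc k)
  have "oprod u k * c = c * oprod u k" using assms[of "oprod u k"] by (simp add: comm_def)
  then have "c ^ k * (oprod u k * c * u k) = c ^ k * (c * oprod u k * u k)"
    by simp
  then have "c ^ k * (oprod u k * (c * u k)) = c ^ k * (c * (oprod u k * u k))"
    by (simp only: mult.assoc)
  then show ?case using Suc by (simp add: oprod_Suc mult.assoc power_Suc2 del: power_Suc)
qed simp

lemma prod_list_acomm:
  "(\<And>b. b \<in> set bs \<Longrightarrow> acomm b a) \<Longrightarrow> prod_list bs * a = (- 1) ^ length bs * (a * prod_list bs)"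
proof (induction bs)
  case (Cons b bs)
  have "b * prod_list bs * a = b * ((- 1) ^ length bs * (a * prod_list bs))"
    using Cons by (simp add: mult.assoc)
  also have "\<dots> = (- 1) ^ length bs * (b * a * prod_list bs)"
    by (cases "even (length bs)") (simp_all add: mult.assoc)
  also have "b * a = - (a * b)" using Cons.prems[of b] by (simp add: acomm_def)
  finally show ?case by (simp add: mult.assoc)
qed simp

lemma oprod_acomm:
  "(\<And>i. i < k \<Longrightarrow> acomm (u i) a) \<Longrightarrow> oprod u k * a = (- 1) ^ k * (a * oprod u k)"
  unfolding oprod_def by (subst prod_list_acomm) auto

text \<open>
  The sign is that of the permutation taking \<open>u 0, v 0, u 1, v 1, \<dots>\<close> to
  \<open>u 0, u 1, \<dots>, v 0, v 1, \<dots>\<close>.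
\<close>

lemma oprod_interleave:
  assumes "\<And>i j. i < k \<Longrightarrow> j < k \<Longrightarrow> acomm (v i) (u j)"
  shows "oprod (\<lambda>i. u i * v i) k = (- 1) ^ (k choose 2) * (oprod u k * oprod v k)"
  using assms
proof (induction k)
  case (Suc k)
  have "oprod (\<lambda>i. u i * v i) (Suc k)
      = (- 1) ^ (k choose 2) * (oprod u k * (oprod v k * u k) * v k)"
    using Suc by (simp add: oprod_Suc mult.assoc)
  also have "oprod v k * u k = (- 1) ^ k * (u k * oprod v k)"
    using Suc.prems by (intro oprod_acomm) auto
  also have "(- 1) ^ (k choose 2) * (oprod u k * ((- 1) ^ k * (u k * oprod v k)) * v k)
     = (- 1) ^ (k + (k choose 2)) * (oprod u (Suc k) * oprod v (Suc k))"
    by (cases "even k"; cases "even (k choose 2)") (simp_all add: oprod_Suc mult.assoc)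
  also have "k + (k choose 2) = Suc k choose 2" by (simp add: numeral_2_eq_2)
  finally show ?case .
qed (simp add: numeral_2_eq_2)


section \<open>Anticommuting families and the column determinant\<close>

text \<open>
  The elements \<open>\<psi> 0, \<dots>, \<psi> (N - 1)\<close> satisfy the Grassmann relations. That squares vanish is
  required separately, since it does not follow from anticommutation in characteristic two.
\<close>

definition anticommuting :: "nat \<Rightarrow> (nat \<Rightarrow> 'a::ring_1) \<Rightarrow> bool" where
  "anticommuting N \<psi> \<longleftrightarrow> (\<forall>i<N. \<forall>j<N. acomm (\<psi> i) (\<psi> j)) \<and> (\<forall>i<N. \<psi> i * \<psi> i = 0)"

lemma anticommutingD: "anticommuting N \<psi> \<Longrightarrow> i < N \<Longrightarrow> j < N \<Longrightarrow> acomm (\<psi> i) (\<psi> j)"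
  and anticommuting_square: "anticommuting N \<psi> \<Longrightarrow> i < N \<Longrightarrow> \<psi> i * \<psi> i = 0"
  by (simp_all add: anticommuting_def)

lemma prod_list_not_distinct:
  assumes \<psi>: "anticommuting N \<psi>" and l: "set l \<subseteq> {..<N}" "\<not> distinct l"
  shows "prod_list (map \<psi> l) = 0"
proof -
  from not_distinct_decomp[OF l(2)] obtain xs ys zs a where l': "l = xs @ [a] @ ys @ [a] @ zs" by auto
  have "prod_list (map \<psi> ys) * \<psi> a = (- 1) ^ length ys * (\<psi> a * prod_list (map \<psi> ys))"
    using \<psi> l l' by (subst prod_list_acomm) (auto simp: anticommuting_def)
  then have "\<psi> a * (prod_list (map \<psi> ys) * \<psi> a)
     = (- 1) ^ length ys * (\<psi> a * \<psi> a * prod_list (map \<psi> ys))"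
    by (cases "even (length ys)") (simp_all add: mult.assoc)
  also have "\<psi> a * \<psi> a = 0" using \<psi> l l' by (auto simp: anticommuting_def)
  finally have "\<psi> a * (prod_list (map \<psi> ys) * \<psi> a) = 0" by simp
  then have "prod_list (map \<psi> xs) * (\<psi> a * (prod_list (map \<psi> ys) * \<psi> a)) * prod_list (map \<psi> zs) = 0"
    by simp
  then show ?thesis unfolding l' by (simp add: mult.assoc)
qed

lemma oprod_transpose:
  assumes \<psi>: "anticommuting N \<psi>" and ab: "a < N" "b < N" "a \<noteq> b"
  shows "oprod (\<psi> \<circ> Transposition.transpose a b) N = - oprod \<psi> N"
proof -
  have *: "oprod (\<psi> \<circ> Transposition.transpose a b) N = - oprod \<psi> N" if ab: "a < b" "b < N" for a b
  proof -
    have up: "[0..<N] = [0..<a] @ [a] @ [Suc a..<b] @ [b] @ [Suc b..<N]"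
    proof -
      have "[0..<N] = [0..<a] @ [a..<N]" using ab upt_add_eq_append[of 0 a "N - a"] by simp
      moreover have "[a..<N] = a # [Suc a..<N]" using ab by (intro upt_conv_Cons) simp
      moreover have "[Suc a..<N] = [Suc a..<b] @ [b..<N]"
        using ab upt_add_eq_append[of "Suc a" b "N - b"] by simp
      moreover have "[b..<N] = b # [Suc b..<N]" using ab by (intro upt_conv_Cons) simp
      ultimately show ?thesis by simp
    qed
    let ?v = "prod_list (map \<psi> [Suc a..<b])"
    have e1: "map (\<psi> \<circ> Transposition.transpose a b) [0..<a] = map \<psi> [0..<a]"
      "map (\<psi> \<circ> Transposition.transpose a b) [Suc a..<b] = map \<psi> [Suc a..<b]"
      "map (\<psi> \<circ> Transposition.transpose a b) [Suc b..<N] = map \<psi> [Suc b..<N]"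
      using ab by (auto simp: transpose_def)
    define s :: 'a where "s = (- 1) ^ length [Suc a..<b]"
    have c1: "?v * \<psi> c = s * (\<psi> c * ?v)" if "c < N" for c
      unfolding s_def
      by (rule prod_list_acomm[of "map \<psi> [Suc a..<b]", unfolded length_map])
        (use \<psi> ab that in \<open>auto simp: anticommuting_def\<close>)
    have s: "s = 1 \<or> s = - 1" by (cases "even (length [Suc a..<b])") (simp_all add: s_def)
    have "\<psi> b * \<psi> a = - (\<psi> a * \<psi> b)"
      using anticommutingD[OF \<psi>, of b a] ab by (simp add: acomm_def)
    then have a0: "\<psi> b * \<psi> a * ?v = - (\<psi> a * \<psi> b * ?v)" by simp
    have a1: "\<psi> b * (?v * \<psi> a) = - (\<psi> a * (?v * \<psi> b))"
    proof -
      have "?v * \<psi> a = s * (\<psi> a * ?v)" "?v * \<psi> b = s * (\<psi> b * ?v)" using c1 ab by auto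
      moreover from s have "\<psi> b * (s * (\<psi> a * ?v)) = - (\<psi> a * (s * (\<psi> b * ?v)))"
      proof
        assume "s = 1"
        then show ?thesis using a0 by (simp only: mult_1_left mult.assoc)
      next
        assume "s = - 1"
        then show ?thesis using a0 by (simp only: mult_1_left mult.assoc mult_minus_left mult_minus_right)
      qed
      ultimately show ?thesis by (simp only:)
    qed
    have *: "\<psi> b * (?v * (\<psi> a * w)) = - (\<psi> a * (?v * (\<psi> b * w)))" for w
    proof -
      have "\<psi> b * (?v * (\<psi> a * w)) = \<psi> b * (?v * \<psi> a) * w" by (simp only: mult.assoc)
      also have "\<dots> = - (\<psi> a * (?v * \<psi> b)) * w" using a1 by simp
      finally show ?thesis by (simp add: mult.assoc)
    qed
    show ?thesis
      unfolding oprod_def up map_append prod_list.append e1 using *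
      by (simp add: transpose_def)
  qed
  show ?thesis using *[of a b] *[of b a] ab transpose_commute[of a b] by (metis linorder_neqE_nat)
qed

lemma oprod_permutes:
  assumes "p permutes {0..<N}" "anticommuting N \<psi>"
  shows "oprod (\<psi> \<circ> p) N = of_int (sign p) * oprod \<psi> N"
proof -
  have "\<forall>\<psi> :: nat \<Rightarrow> 'a. anticommuting N \<psi> \<longrightarrow> oprod (\<psi> \<circ> p) N = of_int (sign p) * oprod \<psi> N"
    using assms(1) finite_atLeastLessThan
  proof (induction rule: permutes_induct)
    case id
    then show ?case by simp
  next
    case (swap a b p)
    show ?case
    proof (intro allI impI)
      fix \<psi> :: "nat \<Rightarrow> 'a" assume \<psi>: "anticommuting N \<psi>"
      have "anticommuting N (\<psi> \<circ> Transposition.transpose a b)"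
        using \<psi> swap(1,2) by (auto simp: anticommuting_def transpose_def)
      then have "oprod (\<psi> \<circ> Transposition.transpose a b \<circ> p) N
          = of_int (sign p) * oprod (\<psi> \<circ> Transposition.transpose a b) N"
        using swap.IH by blast
      also have "oprod (\<psi> \<circ> Transposition.transpose a b) N = - oprod \<psi> N"
        using \<psi> swap.hyps by (intro oprod_transpose) auto
      also have "of_int (sign p) * - oprod \<psi> N
          = of_int (sign (Transposition.transpose a b \<circ> p)) * oprod \<psi> N"
        using swap.hyps permutes_imp_permutation[of "{0..<N}" p]
        by (simp add: sign_compose sign_swap_id permutation_swap_id)
      finally show "oprod (\<psi> \<circ> (Transposition.transpose a b \<circ> p)) N
          = of_int (sign (Transposition.transpose a b \<circ> p)) * oprod \<psi> N"
        by (simp only: comp_assoc)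
    qed
  qed
  then show ?thesis using assms(2) by blast
qed

text \<open>Column determinant of the \<open>N \<times> N\<close> array \<open>M\<close>.\<close>

definition cdet :: "nat \<Rightarrow> (nat \<Rightarrow> nat \<Rightarrow> 'a::ring_1) \<Rightarrow> 'a" where
  "cdet N M = (\<Sum>\<sigma> | \<sigma> permutes {0..<N}. of_int (sign \<sigma>) * oprod (\<lambda>j. M (\<sigma> j) j) N)"

text \<open>
  The maps \<open>{..<k} \<rightarrow> {..<N}\<close>, extended by the identity so that for \<open>k = N\<close> the injective ones are
  exactly the permutations of \<open>{0..<N}\<close>.
\<close>

definition words :: "nat \<Rightarrow> nat \<Rightarrow> (nat \<Rightarrow> nat) set" where
  "words N k = {f. (\<forall>i<k. f i < N) \<and> (\<forall>i\<ge>k. f i = i)}"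

lemma words_0: "words N 0 = {id}"
  by (auto simp: words_def)

lemma words_Suc: "bij_betw (\<lambda>(f, a). f(k := a)) (words N k \<times> {..<N}) (words N (Suc k))"
proof (rule bij_betw_byWitness[where f' = "\<lambda>f. (f(k := k), f k)"])
qed (auto simp: words_def fun_eq_iff)

lemma finite_words: "finite (words N k)"
proof (induction k)
  case (Suc k)
  then show ?case using bij_betw_finite[OF words_Suc[of k N]] by simp
qed (simp add: words_0)

text \<open>
  The normally ordered product of the first \<open>k\<close> columns of \<open>M\<close>: the product of the sums
  \<open>\<Sum>i<N. \<psi> i * M i j\<close>, expanded as if every \<open>\<psi>\<close> could be moved to the left of every entry.
\<close>

definition nprod :: "nat \<Rightarrow> (nat \<Rightarrow> 'a::ring_1) \<Rightarrow> (nat \<Rightarrow> nat \<Rightarrow> 'a) \<Rightarrow> nat \<Rightarrow> 'a" where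
  "nprod N \<psi> M k = (\<Sum>f\<in>words N k. oprod (\<psi> \<circ> f) k * oprod (\<lambda>j. M (f j) j) k)"

lemma nprod_0 [simp]: "nprod N \<psi> M 0 = 1"
  by (simp add: nprod_def words_0)

lemma nprod_Suc:
  "nprod N \<psi> M (Suc k)
     = (\<Sum>a<N. \<Sum>f\<in>words N k. oprod (\<psi> \<circ> f) k * \<psi> a * (oprod (\<lambda>j. M (f j) j) k * M a k))"
proof -
  have "nprod N \<psi> M (Suc k) = (\<Sum>f\<in>words N (Suc k).
      oprod (\<psi> \<circ> f) k * \<psi> (f k) * (oprod (\<lambda>j. M (f j) j) k * M (f k) k))"
    by (simp add: nprod_def oprod_Suc)
  also have "\<dots> = (\<Sum>(f, a)\<in>words N k \<times> {..<N}.
      oprod (\<psi> \<circ> f(k := a)) k * \<psi> a * (oprod (\<lambda>j. M ((f(k := a)) j) j) k * M a k))"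
    by (subst sum.reindex_bij_betw[OF words_Suc, symmetric]) (simp add: case_prod_unfold)
  also have "\<dots> = (\<Sum>(f, a)\<in>words N k \<times> {..<N}.
      oprod (\<psi> \<circ> f) k * \<psi> a * (oprod (\<lambda>j. M (f j) j) k * M a k))"
    by (intro sum.cong refl, clarify, intro arg_cong2[of _ _ _ _ "(*)"] refl oprod_cong) auto
  also have "\<dots> = (\<Sum>f\<in>words N k. \<Sum>a<N.
      oprod (\<psi> \<circ> f) k * \<psi> a * (oprod (\<lambda>j. M (f j) j) k * M a k))"
    by (subst sum.cartesian_product) simp
  finally show ?thesis by (subst sum.swap)
qed

text \<open>
  No relation between \<open>\<psi>\<close> and the entries of \<open>M\<close> is needed here; this is what makes the statement
  applicable to the Capelli identity, where \<open>\<zeta>\<close> and \<open>D\<close> do not commute.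
\<close>

lemma nprod_full:
  assumes \<psi>: "anticommuting N \<psi>"
  shows "nprod N \<psi> M N = oprod \<psi> N * cdet N M"
proof -
  have sub: "{\<sigma>. \<sigma> permutes {0..<N}} \<subseteq> words N N"
    by (auto simp: words_def permutes_not_in dest: permutes_in_image)
  have zero: "oprod (\<psi> \<circ> f) N = 0" if f: "f \<in> words N N" "\<not> f permutes {0..<N}" for f
  proof -
    have "\<not> inj_on f {0..<N}"
    proof
      assume inj: "inj_on f {0..<N}"
      have "f ` {0..<N} \<subseteq> {0..<N}" using f by (auto simp: words_def)
      then have "bij_betw f {0..<N} {0..<N}"
        using inj by (simp add: bij_betw_def endo_inj_surj)
      then have "f permutes {0..<N}"
        using f by (intro bij_imp_permutes) (auto simp: words_def)
      then show False using f by simp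
    qed
    then have "\<not> distinct (map f [0..<N])" by (simp add: distinct_map)
    then have "prod_list (map \<psi> (map f [0..<N])) = 0"
      using f by (intro prod_list_not_distinct[OF \<psi>]) (auto simp: words_def)
    then show ?thesis by (simp add: oprod_def)
  qed
  have "nprod N \<psi> M N = (\<Sum>f | f permutes {0..<N}. oprod (\<psi> \<circ> f) N * oprod (\<lambda>j. M (f j) j) N)"
    unfolding nprod_def using zero
    by (intro sum.mono_neutral_right finite_words sub) auto
  also have "\<dots> = (\<Sum>f | f permutes {0..<N}.
      oprod \<psi> N * (of_int (sign f) * oprod (\<lambda>j. M (f j) j) N))"
  proof (intro sum.cong refl)
    fix f assume "f \<in> {f. f permutes {0..<N}}"
    then have "oprod (\<psi> \<circ> f) N = oprod \<psi> N * of_int (sign f)"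
      using oprod_permutes[OF _ \<psi>, of f] by (simp add: mult_of_int_commute)
    then show "oprod (\<psi> \<circ> f) N * oprod (\<lambda>j. M (f j) j) N
      = oprod \<psi> N * (of_int (sign f) * oprod (\<lambda>j. M (f j) j) N)"
      by (simp add: mult.assoc)
  qed
  finally show ?thesis by (simp add: cdet_def sum_distrib_left)
qed

lemma oprod_columns:
  assumes \<psi>: "anticommuting N \<psi>"
    and M: "\<And>a i j. a < N \<Longrightarrow> i < N \<Longrightarrow> j < N \<Longrightarrow> comm (\<psi> a) (M i j)"
  shows "oprod (\<lambda>j. \<Sum>i<N. \<psi> i * M i j) N = oprod \<psi> N * cdet N M"
proof -
  have "k \<le> N \<Longrightarrow> oprod (\<lambda>j. \<Sum>i<N. \<psi> i * M i j) k = nprod N \<psi> M k" for k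
  proof (induction k)
    case (Suc k)
    have "oprod (\<lambda>j. \<Sum>i<N. \<psi> i * M i j) (Suc k) = nprod N \<psi> M k * (\<Sum>i<N. \<psi> i * M i k)"
      using Suc by (simp add: oprod_Suc)
    also have "\<dots> = (\<Sum>a<N. \<Sum>f\<in>words N k.
        oprod (\<psi> \<circ> f) k * oprod (\<lambda>j. M (f j) j) k * (\<psi> a * M a k))"
      by (simp add: nprod_def sum_distrib_left sum_distrib_right)
    also have "\<dots> = nprod N \<psi> M (Suc k)"
      unfolding nprod_Suc
    proof (intro sum.cong refl)
      fix a f assume a: "a \<in> {..<N}" and f: "f \<in> words N k"
      have "comm (\<psi> a) (oprod (\<lambda>j. M (f j) j) k)"
        using a f Suc.prems by (intro comm_oprod M) (auto simp: words_def)
      then have "oprod (\<psi> \<circ> f) k * (oprod (\<lambda>j. M (f j) j) k * \<psi> a) * M a k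
        = oprod (\<psi> \<circ> f) k * (\<psi> a * oprod (\<lambda>j. M (f j) j) k) * M a k"
        by (simp add: comm_def)
      then show "oprod (\<psi> \<circ> f) k * oprod (\<lambda>j. M (f j) j) k * (\<psi> a * M a k)
        = oprod (\<psi> \<circ> f) k * \<psi> a * (oprod (\<lambda>j. M (f j) j) k * M a k)"
        by (simp only: mult.assoc)
    qed
    finally show ?case .
  qed simp
  from this[of N] show ?thesis by (simp add: nprod_full[OF \<psi>])
qed

lemma comm_cdet:
  assumes "\<And>i j. i < N \<Longrightarrow> j < N \<Longrightarrow> comm a (M i j)"
  shows "comm a (cdet N M)"
  unfolding cdet_def
proof (intro comm_sum comm_mult comm_of_int comm_oprod)
  fix \<sigma> i assume "\<sigma> \<in> {\<sigma>. \<sigma> permutes {0..<N}}" "i < N"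
  then show "comm a (M (\<sigma> i) i)"
    by (intro assms) (auto dest: permutes_in_image[of \<sigma> _ i])
qed


section \<open>The Capelli identity\<close>

text \<open>
  The indices of \<open>D\<close> are those of \<open>Z\<close>: \<open>D b c\<close> behaves like the derivative with respect to
  \<open>Z b c\<close>.
\<close>

locale capelli =
  fixes n :: nat and \<theta> :: "nat \<Rightarrow> 'a::ring_1" and Z D :: "nat \<Rightarrow> nat \<Rightarrow> 'a"
  assumes torsion_free: "(w :: 'a) + w = 0 \<Longrightarrow> w = 0"
    and \<theta>: "anticommuting n \<theta>"
    and \<theta>_Z: "\<lbrakk>a < n; b < n; c < n\<rbrakk> \<Longrightarrow> comm (\<theta> a) (Z b c)"
    and \<theta>_D: "\<lbrakk>a < n; b < n; c < n\<rbrakk> \<Longrightarrow> comm (\<theta> a) (D b c)"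
    and Z_Z: "\<lbrakk>a < n; b < n; c < n; d < n\<rbrakk> \<Longrightarrow> comm (Z a b) (Z c d)"
    and D_D: "\<lbrakk>a < n; b < n; c < n; d < n\<rbrakk> \<Longrightarrow> comm (D a b) (D c d)"
    and D_Z: "\<lbrakk>a < n; b < n; c < n; d < n\<rbrakk> \<Longrightarrow>
      D b c * Z a d = Z a d * D b c + (if a = b \<and> c = d then 1 else 0)"
begin

text \<open>
  The columns of \<open>Z\<close> and of \<open>Z D\<^sup>t\<close>, and the latter with a shift by \<open>t\<close> on the diagonal.
\<close>

definition \<zeta> :: "nat \<Rightarrow> 'a" where
  "\<zeta> c = (\<Sum>a<n. \<theta> a * Z a c)"

definition \<eta> :: "nat \<Rightarrow> 'a" where
  "\<eta> b = (\<Sum>c<n. \<zeta> c * D b c)"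

definition H :: "int \<Rightarrow> nat \<Rightarrow> 'a" where
  "H t b = \<eta> b + of_int t * \<theta> b"

lemma \<theta>_\<zeta>: "a < n \<Longrightarrow> c < n \<Longrightarrow> acomm (\<theta> a) (\<zeta> c)"
  unfolding \<zeta>_def
  by (intro acomm_sum acomm_mult_comm \<theta>_Z anticommutingD[OF \<theta>]) auto

lemma \<theta>_\<eta>: "a < n \<Longrightarrow> b < n \<Longrightarrow> acomm (\<theta> a) (\<eta> b)"
  unfolding \<eta>_def by (intro acomm_sum acomm_mult_comm \<theta>_\<zeta> \<theta>_D) auto

lemma Z_\<zeta>: "\<lbrakk>a < n; b < n; c < n\<rbrakk> \<Longrightarrow> comm (Z a b) (\<zeta> c)"
  unfolding \<zeta>_def by (intro comm_sum comm_mult Z_Z comm_sym[OF \<theta>_Z]) auto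

lemma \<zeta>_\<zeta>: "c < n \<Longrightarrow> d < n \<Longrightarrow> acomm (\<zeta> c) (\<zeta> d)"
  by (subst (2) \<zeta>_def)
    (intro acomm_sum acomm_mult_comm acomm_sym[OF \<theta>_\<zeta>] comm_sym[OF Z_\<zeta>]; simp)

lemma anticommuting_\<zeta>: "anticommuting n \<zeta>"
  unfolding anticommuting_def
proof (intro conjI allI impI)
  fix c assume "c < n"
  then have "\<zeta> c * \<zeta> c = - (\<zeta> c * \<zeta> c)" using \<zeta>_\<zeta> unfolding acomm_def by blast
  then have "\<zeta> c * \<zeta> c + \<zeta> c * \<zeta> c = 0" by (simp only: eq_neg_iff_add_eq_0)
  then show "\<zeta> c * \<zeta> c = 0" by (rule torsion_free)
qed (rule \<zeta>_\<zeta>)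

lemma D_\<zeta>:
  assumes "b < n" "c < n" "d < n"
  shows "D b c * \<zeta> d = \<zeta> d * D b c + (if c = d then \<theta> b else 0)"
proof -
  have "D b c * \<zeta> d = (\<Sum>a<n. \<theta> a * Z a d * D b c + (if a = b then if c = d then \<theta> a else 0 else 0))"
    unfolding \<zeta>_def sum_distrib_left
  proof (intro sum.cong refl)
    fix a assume a: "a \<in> {..<n}"
    have "D b c * (\<theta> a * Z a d) = \<theta> a * (D b c * Z a d)"
      using \<theta>_D[of a b c] a assms by (simp add: comm_def mult.assoc[symmetric])
    also have "\<dots> = \<theta> a * Z a d * D b c + (if a = b then if c = d then \<theta> a else 0 else 0)"
      using a assms by (subst D_Z) (auto simp: distrib_left mult.assoc)
    finally show "D b c * (\<theta> a * Z a d)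
      = \<theta> a * Z a d * D b c + (if a = b then if c = d then \<theta> a else 0 else 0)" .
  qed
  also have "\<dots> = \<zeta> d * D b c + (if c = d then \<theta> b else 0)"
    using assms by (simp add: sum.distrib \<zeta>_def sum_distrib_right)
  finally show ?thesis .
qed

lemma \<eta>_\<zeta>:
  assumes "b < n" "d < n"
  shows "\<eta> b * \<zeta> d = - (\<zeta> d * \<eta> b) + \<zeta> d * \<theta> b"
proof -
  have "\<eta> b * \<zeta> d = (\<Sum>c<n. - (\<zeta> d * (\<zeta> c * D b c)) + (if c = d then \<zeta> c * \<theta> b else 0))"
    unfolding \<eta>_def sum_distrib_right
  proof (intro sum.cong refl)
    fix c assume "c \<in> {..<n}"
    then have c: "c < n" by simp
    have "\<zeta> c * D b c * \<zeta> d = \<zeta> c * \<zeta> d * D b c + (if c = d then \<zeta> c * \<theta> b else 0)"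
      using D_\<zeta>[OF assms(1) c assms(2)] by (simp add: mult.assoc distrib_left)
    also have "\<zeta> c * \<zeta> d = - (\<zeta> d * \<zeta> c)" using \<zeta>_\<zeta>[OF c assms(2)] by (simp only: acomm_def)
    finally show "\<zeta> c * D b c * \<zeta> d
      = - (\<zeta> d * (\<zeta> c * D b c)) + (if c = d then \<zeta> c * \<theta> b else 0)"
      by (simp add: mult.assoc)
  qed
  also have "\<dots> = - (\<zeta> d * \<eta> b) + \<zeta> d * \<theta> b"
    using assms by (simp add: sum_subtractf \<eta>_def sum_distrib_left)
  finally show ?thesis .
qed

text \<open>
  The step behind the Capelli identity: passing \<open>\<zeta>\<close> through a column lowers its shift by one.
\<close>

lemma H_\<zeta>:
  assumes "b < n" "d < n"
  shows "H t b * \<zeta> d = - (\<zeta> d * H (t - 1) b)"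
proof -
  have "\<theta> b * \<zeta> d = - (\<zeta> d * \<theta> b)" using \<theta>_\<zeta>[OF assms] by (simp only: acomm_def)
  then have "of_int t * \<theta> b * \<zeta> d = - (of_int t * (\<zeta> d * \<theta> b))" by (simp add: mult.assoc)
  also have "of_int t * (\<zeta> d * \<theta> b) = \<zeta> d * (of_int t * \<theta> b)"
    using mult_of_int_commute[of t "\<zeta> d"] by (simp add: mult.assoc[symmetric])
  finally show ?thesis using \<eta>_\<zeta>[OF assms] by (simp add: H_def algebra_simps)
qed

lemma oprod_H_\<zeta>:
  assumes "k \<le> n" "c < n"
  shows "oprod (\<lambda>m. H (t - int m) m) k * \<zeta> c
    = (- 1) ^ k * (\<zeta> c * oprod (\<lambda>m. H (t - 1 - int m) m) k)"
  using assms(1)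
proof (induction k)
  case (Suc k)
  have "oprod (\<lambda>m. H (t - int m) m) (Suc k) * \<zeta> c
      = - (oprod (\<lambda>m. H (t - int m) m) k * \<zeta> c * H (t - 1 - int k) k)"
    using Suc.prems assms(2) H_\<zeta>[of k c "t - int k"]
    by (simp add: oprod_Suc mult.assoc algebra_simps)
  also have "\<dots> = (- 1) ^ Suc k * (\<zeta> c * oprod (\<lambda>m. H (t - 1 - int m) m) (Suc k))"
    using Suc by (simp add: oprod_Suc mult.assoc)
  finally show ?case .
qed simp

lemma oprod_H_eq_nprod:
  "k \<le> n \<Longrightarrow> oprod (\<lambda>m. H (int k - 1 - int m) m) k = nprod n \<zeta> (\<lambda>c b. D b c) k"
proof (induction k)
  case (Suc k)
  have "oprod (\<lambda>m. H (int (Suc k) - 1 - int m) m) (Suc k)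
      = (\<Sum>c<n. oprod (\<lambda>m. H (int k - int m) m) k * \<zeta> c * D k c)"
    by (simp add: oprod_Suc H_def[of 0] \<eta>_def sum_distrib_left mult.assoc)
  also have "\<dots> = (\<Sum>c<n. (- 1) ^ k * (\<zeta> c * nprod n \<zeta> (\<lambda>c b. D b c) k) * D k c)"
    using Suc by (intro sum.cong refl) (simp add: oprod_H_\<zeta>)
  also have "\<dots> = nprod n \<zeta> (\<lambda>c b. D b c) (Suc k)"
    unfolding nprod_Suc
  proof (intro sum.cong refl)
    fix c assume "c \<in> {..<n}"
    then have "(- 1) ^ k * (\<zeta> c * oprod (\<zeta> \<circ> f) k) = oprod (\<zeta> \<circ> f) k * \<zeta> c"
      if "f \<in> words n k" for f
      using that by (intro oprod_acomm[symmetric]) (auto simp: words_def intro: \<zeta>_\<zeta>)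
    then have "(- 1) ^ k * (\<zeta> c * (oprod (\<zeta> \<circ> f) k * w)) = oprod (\<zeta> \<circ> f) k * \<zeta> c * w"
      if "f \<in> words n k" for f w
      using that by (simp add: mult.assoc[symmetric])
    then show "(- 1) ^ k * (\<zeta> c * nprod n \<zeta> (\<lambda>c b. D b c) k) * D k c
      = (\<Sum>f\<in>words n k. oprod (\<zeta> \<circ> f) k * \<zeta> c * (oprod (\<lambda>j. D j (f j)) k * D k c))"
      unfolding nprod_def sum_distrib_left sum_distrib_right
      by (intro sum.cong refl) (simp add: mult.assoc)
  qed
  finally show ?case .
qed simp

lemma capelli_identity: "oprod (\<lambda>m. H (int n - 1 - int m) m) n = oprod \<zeta> n * cdet n (\<lambda>c b. D b c)"
  using oprod_H_eq_nprod[of n] nprod_full[OF anticommuting_\<zeta>] by simp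

lemma \<eta>_\<eta>:
  assumes b: "b < n"
  shows "\<eta> b * \<eta> b = - (\<theta> b * \<eta> b)"
proof -
  \<comment> \<open>antisymmetric in the \<open>\<zeta>\<close> and symmetric in the \<open>D\<close>, hence zero\<close>
  let ?s = "\<Sum>d<n. \<Sum>c<n. \<zeta> d * \<zeta> c * D b c * D b d"
  have "?s = (\<Sum>d<n. \<Sum>c<n. - (\<zeta> c * \<zeta> d * D b d * D b c))"
  proof (intro sum.cong refl)
    fix d c assume "d \<in> {..<n}" "c \<in> {..<n}"
    then have "\<zeta> d * \<zeta> c = - (\<zeta> c * \<zeta> d)" "D b c * D b d = D b d * D b c"
      using \<zeta>_\<zeta>[of d c] D_D[of b c b d] b by (simp_all only: acomm_def comm_def lessThan_iff)
    then show "\<zeta> d * \<zeta> c * D b c * D b d = - (\<zeta> c * \<zeta> d * D b d * D b c)"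
      by (simp add: mult.assoc)
  qed
  also have "\<dots> = - ?s" by (subst sum.swap) (simp add: sum_negf)
  finally have "?s + ?s = 0" by (simp only: eq_neg_iff_add_eq_0)
  then have s: "?s = 0" by (rule torsion_free)
  have "\<eta> b * \<eta> b = (\<Sum>d<n. \<eta> b * \<zeta> d * D b d)"
    by (subst (2) \<eta>_def) (simp add: sum_distrib_left mult.assoc)
  also have "\<dots> = (\<Sum>d<n. \<zeta> d * \<theta> b * D b d) - (\<Sum>d<n. \<zeta> d * \<eta> b * D b d)"
    using b by (simp add: \<eta>_\<zeta> sum_subtractf algebra_simps)
  also have "(\<Sum>d<n. \<zeta> d * \<eta> b * D b d) = ?s"
    by (simp add: \<eta>_def sum_distrib_left sum_distrib_right mult.assoc)
  also have "(\<Sum>d<n. \<zeta> d * \<theta> b * D b d) = (\<Sum>d<n. - (\<theta> b * (\<zeta> d * D b d)))"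
  proof (intro sum.cong refl)
    fix d assume "d \<in> {..<n}"
    then have "\<zeta> d * \<theta> b = - (\<theta> b * \<zeta> d)"
      using acomm_sym[OF \<theta>_\<zeta>[of b d]] b by (simp only: acomm_def lessThan_iff)
    then show "\<zeta> d * \<theta> b * D b d = - (\<theta> b * (\<zeta> d * D b d))" by (simp add: mult.assoc)
  qed
  also have "\<dots> = - (\<theta> b * \<eta> b)" by (simp add: \<eta>_def sum_distrib_left sum_negf)
  finally show ?thesis using s by simp
qed

text \<open>
  The entries of \<open>Z D\<^sup>t\<close> satisfy the \<open>gl n\<close> commutation relations, so a column need not square to
  zero. For one of each two conjugate columns the entries \<open>1/4\<close> and \<open>\<i>/4\<close> of the correction
  matrix compensate this defect.
\<close>

lemma H_H:
  assumes b: "b < n"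
  shows "H t b * H t b = - (\<theta> b * H t b)"
proof -
  have 0: "\<theta> b * \<theta> b = 0" using anticommuting_square[OF \<theta> b] .
  have 1: "\<eta> b * (of_int t * \<theta> b) = - (of_int t * \<theta> b * \<eta> b)"
    using acomm_sym[OF acomm_comm_mult[OF comm_of_int acomm_sym[OF \<theta>_\<eta>[OF b b]], THEN acomm_sym], of t]
    by (simp only: acomm_def)
  have 2: "\<theta> b * (of_int t * \<theta> b) = 0"
    using 0 mult_of_int_commute[of t "\<theta> b"] by (metis mult.assoc mult_zero_right)
  show ?thesis
    using 0 1 2 \<eta>_\<eta>[OF b] by (simp add: H_def distrib_left distrib_right mult.assoc)
qed

end


section \<open>Degree in an anticommuting family\<close>

text \<open>
  An element counts as having degree at least \<open>j\<close> in \<open>\<theta> 0, \<dots>, \<theta> (n - 1)\<close> if multiplying it from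
  the right by more than \<open>n - j\<close> of these variables gives zero. This needs no grading of the
  ambient ring, and only \<open>0\<close> has degree at least \<open>n + 1\<close> (take the empty word).
\<close>

definition deg_ge :: "nat \<Rightarrow> (nat \<Rightarrow> 'a::ring_1) \<Rightarrow> nat \<Rightarrow> 'a set" where
  "deg_ge n \<theta> j = {w. \<forall>l. set l \<subseteq> {..<n} \<longrightarrow> n < length l + j \<longrightarrow> w * prod_list (map \<theta> l) = 0}"

lemma deg_ge_one:
  assumes "anticommuting n \<theta>"
  shows "1 \<in> deg_ge n \<theta> 0"
proof -
  have "prod_list (map \<theta> l) = 0" if l: "set l \<subseteq> {..<n}" "n < length l" for l
  proof (rule prod_list_not_distinct[OF assms l(1)])
    show "\<not> distinct l"
      using l card_mono[OF _ l(1)] by (auto dest: distinct_card)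
  qed
  then show ?thesis by (simp add: deg_ge_def)
qed

lemma deg_ge_Suc: "w \<in> deg_ge n \<theta> (Suc j) \<Longrightarrow> w \<in> deg_ge n \<theta> j"
  by (simp add: deg_ge_def)

lemma deg_ge_top: "w \<in> deg_ge n \<theta> (Suc n) \<Longrightarrow> w = 0"
  by (auto simp: deg_ge_def dest: spec[of _ "[]"])

lemma deg_ge_add: "v \<in> deg_ge n \<theta> j \<Longrightarrow> w \<in> deg_ge n \<theta> j \<Longrightarrow> v + w \<in> deg_ge n \<theta> j"
  by (simp add: deg_ge_def distrib_right)

lemma deg_ge_lmult: "w \<in> deg_ge n \<theta> j \<Longrightarrow> v * w \<in> deg_ge n \<theta> j"
  by (simp add: deg_ge_def mult.assoc)

lemma deg_ge_sum: "(\<And>i. i \<in> S \<Longrightarrow> f i \<in> deg_ge n \<theta> j) \<Longrightarrow> sum f S \<in> deg_ge n \<theta> j"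
  by (simp add: deg_ge_def sum_distrib_right)

lemma deg_ge_gen:
  assumes w: "w \<in> deg_ge n \<theta> j" and a: "a < n"
  shows "w * \<theta> a \<in> deg_ge n \<theta> (Suc j)"
  unfolding deg_ge_def
proof (intro CollectI allI impI)
  fix l assume "set l \<subseteq> {..<n}" "n < length l + Suc j"
  then have "w * prod_list (map \<theta> (a # l)) = 0"
    using w a unfolding deg_ge_def by (auto dest!: spec[of _ "a # l"])
  then show "w * \<theta> a * prod_list (map \<theta> l) = 0" by (simp add: mult.assoc)
qed

lemma deg_ge_comm:
  assumes w: "w \<in> deg_ge n \<theta> j" and r: "\<And>a. a < n \<Longrightarrow> comm (\<theta> a) r"
  shows "w * r \<in> deg_ge n \<theta> j"
  unfolding deg_ge_def
proof (intro CollectI allI impI)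
  fix l assume l: "set l \<subseteq> {..<n}" "n < length l + j"
  have "comm r (prod_list (map \<theta> l))"
    using l by (intro comm_prod_list) (auto intro: comm_sym r)
  then have "w * r * prod_list (map \<theta> l) = w * prod_list (map \<theta> l) * r"
    by (simp add: comm_def mult.assoc)
  also have "\<dots> = 0" using w l by (simp add: deg_ge_def)
  finally show "w * r * prod_list (map \<theta> l) = 0" .
qed

lemma deg_ge_acomm:
  assumes w: "w \<in> deg_ge n \<theta> j" and r: "\<And>a. a < n \<Longrightarrow> acomm (\<theta> a) r"
  shows "w * r \<in> deg_ge n \<theta> j"
  unfolding deg_ge_def
proof (intro CollectI allI impI)
  fix l assume l: "set l \<subseteq> {..<n}" "n < length l + j"
  have "prod_list (map \<theta> l) * r = (- 1) ^ length (map \<theta> l) * (r * prod_list (map \<theta> l))"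
    using l by (intro prod_list_acomm) (auto intro: r)
  then have "r * prod_list (map \<theta> l) = (- 1) ^ length l * (prod_list (map \<theta> l) * r)"
    by (cases "even (length l)") simp_all
  then have "w * r * prod_list (map \<theta> l) = (- 1) ^ length l * (w * prod_list (map \<theta> l) * r)"
    by (cases "even (length l)") (simp_all add: mult.assoc)
  also have "\<dots> = 0" using w l by (simp add: deg_ge_def)
  finally show "w * r * prod_list (map \<theta> l) = 0" .
qed

text \<open>
  If every \<open>u b\<close> raises the degree by one and every \<open>v b\<close> by two, then among the terms of the
  expanded product only the product of the \<open>u b\<close> has degree at most \<open>n\<close>.
\<close>

lemma oprod_drop_excess:
  assumes \<theta>: "anticommuting n \<theta>"
    and u: "\<And>w j b. b < n \<Longrightarrow> w \<in> deg_ge n \<theta> j \<Longrightarrow> w * u b \<in> deg_ge n \<theta> (Suc j)"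
    and v: "\<And>w j b. b < n \<Longrightarrow> w \<in> deg_ge n \<theta> j \<Longrightarrow> w * v b \<in> deg_ge n \<theta> (Suc (Suc j))"
  shows "oprod (\<lambda>b. u b + v b) n = oprod u n"
proof -
  have "k \<le> n \<Longrightarrow> oprod u k \<in> deg_ge n \<theta> k \<and>
      oprod (\<lambda>b. u b + v b) k - oprod u k \<in> deg_ge n \<theta> (Suc k)" for k
  proof (induction k)
    case 0
    show ?case using deg_ge_one[OF \<theta>] by (simp add: deg_ge_def)
  next
    case (Suc k)
    let ?d = "oprod (\<lambda>b. u b + v b) k - oprod u k"
    have IH: "oprod u k \<in> deg_ge n \<theta> k" "?d \<in> deg_ge n \<theta> (Suc k)" and k: "k < n"
      using Suc by auto
    have "oprod (\<lambda>b. u b + v b) (Suc k) - oprod u (Suc k)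
        = ?d * u k + ?d * v k + oprod u k * v k"
      by (simp add: oprod_Suc algebra_simps)
    moreover have "\<dots> \<in> deg_ge n \<theta> (Suc (Suc k))"
      by (intro deg_ge_add u v deg_ge_Suc[OF v] k IH)
    ultimately show ?case using u[OF k IH(1)] by (simp add: oprod_Suc)
  qed
  from this[of n] have "oprod (\<lambda>b. u b + v b) n - oprod u n = 0"
    by (intro deg_ge_top) auto
  then show ?thesis by simp
qed


section \<open>Real forms\<close>

lemma sum_pairs: "(\<Sum>i<2 * n. f i) = (\<Sum>a<n. f (2 * a) + f (2 * a + 1 :: nat))"
  for f :: "nat \<Rightarrow> 'a::comm_monoid_add"
  by (induction n) (simp_all add: add.assoc)

text \<open>
  The real form of \<open>R + \<i> J\<close> as an array indexed from \<open>0\<close>.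
\<close>

definition rform :: "(nat \<Rightarrow> nat \<Rightarrow> 'a::ring_1) \<Rightarrow> (nat \<Rightarrow> nat \<Rightarrow> 'a) \<Rightarrow> nat \<Rightarrow> nat \<Rightarrow> 'a" where
  "rform R J i j =
     (if even i then if even j then R (i div 2) (j div 2) else J (i div 2) (j div 2)
      else if even j then - J (i div 2) (j div 2) else R (i div 2) (j div 2))"

lemma rform_simps [simp]:
  "rform R J (2 * a) (2 * b) = R a b" "rform R J (2 * a) (Suc (2 * b)) = J a b"
  "rform R J (Suc (2 * a)) (2 * b) = - J a b" "rform R J (Suc (2 * a)) (Suc (2 * b)) = R a b"
  by (simp_all add: rform_def)

text \<open>
  The correction matrix for \<open>q = 1/4\<close> and the square root \<open>I\<close> of \<open>-1\<close>. Blocks are counted from \<open>0\<close>,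
  whence \<open>n - 1 - a\<close> in the \<open>a\<close>-th block.
\<close>

definition tform :: "nat \<Rightarrow> 'a::ring_1 \<Rightarrow> 'a \<Rightarrow> nat \<Rightarrow> nat \<Rightarrow> 'a" where
  "tform n q I i j =
     (if i div 2 \<noteq> j div 2 then 0
      else if even i then if even j then of_int (int n - 1 - int (i div 2)) + q else I * q
      else if even j then I * q else of_int (int n - 1 - int (i div 2)) - q)"

lemma tform_simps [simp]:
  "tform n q I (2 * a) (2 * b) = (if a = b then of_int (int n - 1 - int a) + q else 0)"
  "tform n q I (2 * a) (Suc (2 * b)) = (if a = b then I * q else 0)"
  "tform n q I (Suc (2 * a)) (2 * b) = (if a = b then I * q else 0)"
  "tform n q I (Suc (2 * a)) (Suc (2 * b)) = (if a = b then of_int (int n - 1 - int a) - q else 0)"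
  by (simp_all add: tform_def)

lemma comm_if: "comm a b \<Longrightarrow> comm a c \<Longrightarrow> comm a (if R then b else c)"
  by simp

lemma mult_left_commute_central: "comm c x \<Longrightarrow> x * (c * y) = c * (x * y)"
  unfolding comm_def by (simp add: mult.assoc[symmetric])

text \<open>
  The product of the two columns of a block, expressed through \<open>H\<close>, its conjugate \<open>H'\<close> and
  \<open>\<theta>\<close>. Since \<open>H * H = - \<theta> * H\<close>, the term \<open>h * \<theta>\<close> cancels the square of \<open>H\<close>; the
  square of \<open>H'\<close> remains. Without correction (\<open>\<theta> = 0\<close>) the statement covers columns that
  square to zero.
\<close>

lemma two_columns:
  assumes I: "\<And>w. comm I w" "I * I = - 1" and h: "\<And>w. comm h w" "h + h = (1 :: 'a::ring_1)"
    and HH': "acomm H H'" and H'\<theta>: "acomm H' \<theta>" and H\<theta>: "acomm H \<theta>"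
    and HH: "H * H = - (\<theta> * H)" and \<theta>\<theta>: "\<theta> * \<theta> = 0"
  shows "h * (H + H' + h * \<theta>) * (h * I * (H' - H + h * \<theta>)) = h * I * (H * H') + h * (h * I) * (H' * H')"
proof -
  have c: "x * (h * y) = h * (x * y)" for x y by (rule mult_left_commute_central[OF h(1)])
  have hh: "h * z + h * z = z" for z
    using h(2) by (metis distrib_right mult_1_left)
  have e: "(H + H' + h * \<theta>) * (H' - H + h * \<theta>)
      = H * H' - H * H + h * (H * \<theta>) + H' * H' - H' * H + h * (H' * \<theta>) + h * (\<theta> * H') - h * (\<theta> * H)"
    using \<theta>\<theta> by (simp add: distrib_left distrib_right right_diff_distrib left_diff_distrib
      c[of H \<theta>] c[of H' \<theta>] c[of "\<theta>" \<theta>] mult.assoc)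
  have "H' * H = - (H * H')" "H' * \<theta> = - (\<theta> * H')" "H * \<theta> = - (\<theta> * H)"
    using acomm_sym[OF HH'] H'\<theta> H\<theta> by (simp_all only: acomm_def)
  then have e2: "(H + H' + h * \<theta>) * (H' - H + h * \<theta>) = H * H' + H * H' + H' * H'"
    unfolding e using HH hh[of "\<theta> * H"] by (simp add: algebra_simps)
  have "h * (H + H' + h * \<theta>) * (h * I * (H' - H + h * \<theta>))
      = h * (h * ((H + H' + h * \<theta>) * (I * (H' - H + h * \<theta>))))"
    by (simp only: mult.assoc c[of "H + H' + h * \<theta>"])
  also have "\<dots> = h * (h * I * (H * H' + H * H' + H' * H'))"
    unfolding mult_left_commute_central[OF I(1), of "H + H' + h * \<theta>"] e2 by (simp only: mult.assoc)
  also have "\<dots> = h * (h * I * (H * H') + h * I * (H * H')) + h * (h * I) * (H' * H')"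
    by (simp add: distrib_left mult.assoc)
  also have "h * (h * I * (H * H') + h * I * (H * H')) = h * I * (H * H')"
    using hh[of "h * I * (H * H')"] by (simp add: distrib_left)
  finally show ?thesis .
qed

text \<open>
  Here \<open>h\<close> stands for \<open>1/2\<close>, \<open>X + I Y\<close> for \<open>Z\<close> and \<open>U + I V\<close> for \<open>D\<^sup>t\<close>. Hence \<open>U c b\<close> is half the
  derivative with respect to \<open>X b c\<close>, and \<open>V c b\<close> is minus half the derivative with respect to
  \<open>Y b c\<close>.
\<close>

locale real_capelli =
  fixes n :: nat and I h :: "'a::ring_1" and \<psi> :: "nat \<Rightarrow> 'a" and X Y U V :: "nat \<Rightarrow> nat \<Rightarrow> 'a"
  assumes I: "comm I w" "I * I = - 1" and h: "comm h w" "h + h = 1"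
    and \<psi>: "anticommuting (2 * n) \<psi>"
    and \<psi>_X: "\<lbrakk>i < 2 * n; b < n; c < n\<rbrakk> \<Longrightarrow> comm (\<psi> i) (X b c)"
    and \<psi>_Y: "\<lbrakk>i < 2 * n; b < n; c < n\<rbrakk> \<Longrightarrow> comm (\<psi> i) (Y b c)"
    and \<psi>_U: "\<lbrakk>i < 2 * n; b < n; c < n\<rbrakk> \<Longrightarrow> comm (\<psi> i) (U b c)"
    and \<psi>_V: "\<lbrakk>i < 2 * n; b < n; c < n\<rbrakk> \<Longrightarrow> comm (\<psi> i) (V b c)"
    and X_X: "\<lbrakk>a < n; b < n; c < n; d < n\<rbrakk> \<Longrightarrow> comm (X a b) (X c d)"
    and X_Y: "\<lbrakk>a < n; b < n; c < n; d < n\<rbrakk> \<Longrightarrow> comm (X a b) (Y c d)"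
    and Y_Y: "\<lbrakk>a < n; b < n; c < n; d < n\<rbrakk> \<Longrightarrow> comm (Y a b) (Y c d)"
    and U_U: "\<lbrakk>a < n; b < n; c < n; d < n\<rbrakk> \<Longrightarrow> comm (U a b) (U c d)"
    and U_V: "\<lbrakk>a < n; b < n; c < n; d < n\<rbrakk> \<Longrightarrow> comm (U a b) (V c d)"
    and V_V: "\<lbrakk>a < n; b < n; c < n; d < n\<rbrakk> \<Longrightarrow> comm (V a b) (V c d)"
    and U_X: "\<lbrakk>a < n; b < n; c < n; d < n\<rbrakk> \<Longrightarrow>
      U c b * X a d = X a d * U c b + (if a = b \<and> c = d then h else 0)"
    and V_Y: "\<lbrakk>a < n; b < n; c < n; d < n\<rbrakk> \<Longrightarrow>
      V c b * Y a d = Y a d * V c b - (if a = b \<and> c = d then h else 0)"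
    and U_Y: "\<lbrakk>a < n; b < n; c < n; d < n\<rbrakk> \<Longrightarrow> comm (U a b) (Y c d)"
    and V_X: "\<lbrakk>a < n; b < n; c < n; d < n\<rbrakk> \<Longrightarrow> comm (V a b) (X c d)"
begin

text \<open>
  Complex coordinates with respect to \<open>K\<close>, which will be \<open>I\<close> (holomorphic) or \<open>- I\<close>
  (antiholomorphic). The indices of \<open>Dc\<close> are those of \<open>D\<close>, hence transposed.
\<close>

definition \<Theta> :: "'a \<Rightarrow> nat \<Rightarrow> 'a" where "\<Theta> K a = \<psi> (2 * a) + K * \<psi> (2 * a + 1)"
definition Zc :: "'a \<Rightarrow> nat \<Rightarrow> nat \<Rightarrow> 'a" where "Zc K a c = X a c + K * Y a c"
definition Dc :: "'a \<Rightarrow> nat \<Rightarrow> nat \<Rightarrow> 'a" where "Dc K b c = U c b + K * V c b"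

lemma minus_I: "comm (- I) w" "- I * - I = - 1"
  using I(1)[of w] I(2) by (simp_all add: comm_def)

lemma torsion_free: "w + w = 0 \<Longrightarrow> w = (0 :: 'a)"
proof -
  assume "w + w = 0"
  then have "(h + h) * w = 0" by (simp add: distrib_left[symmetric] distrib_right)
  then show ?thesis by (simp add: h(2))
qed

text \<open>
  The two admissible choices of the square root of \<open>-1\<close>.
\<close>

definition imag_unit :: "'a \<Rightarrow> bool" where "imag_unit K \<longleftrightarrow> K = I \<or> K = - I"

lemma imag_unit_simps: "imag_unit I" "imag_unit (- I)" by (simp_all add: imag_unit_def)

lemma imag_unit_comm: "imag_unit K \<Longrightarrow> comm w K"
  using I(1)[of w] minus_I(1)[of w] by (auto simp: imag_unit_def intro: comm_sym)

lemma comm_lin: "\<lbrakk>imag_unit K; comm w r; comm w j\<rbrakk> \<Longrightarrow> comm w (r + K * j)"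
  by (blast intro: comm_add comm_mult imag_unit_comm)

lemma acomm_lin: "\<lbrakk>imag_unit K; acomm w r; acomm w j\<rbrakk> \<Longrightarrow> acomm w (r + K * j)"
  by (blast intro: acomm_add acomm_comm_mult imag_unit_comm)

lemma comm_lin_lin:
  assumes "imag_unit K" "imag_unit L" "comm r r'" "comm r j'" "comm j r'" "comm j j'"
  shows "comm (r + K * j) (r' + L * j')"
  by (rule comm_lin[OF assms(2)]; rule comm_sym; rule comm_lin[OF assms(1)]; rule comm_sym; fact)

lemma acomm_lin_lin:
  assumes "imag_unit K" "imag_unit L" "acomm r r'" "acomm r j'" "acomm j r'" "acomm j j'"
  shows "acomm (r + K * j) (r' + L * j')"
  by (rule acomm_lin[OF assms(2)]; rule acomm_sym; rule acomm_lin[OF assms(1)]; rule acomm_sym; fact)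

lemma \<Theta>_\<Theta>: "\<lbrakk>imag_unit K; imag_unit L; a < n; b < n\<rbrakk> \<Longrightarrow> acomm (\<Theta> K a) (\<Theta> L b)"
  unfolding \<Theta>_def by (intro acomm_lin_lin anticommutingD[OF \<psi>]) simp_all

lemma \<Theta>_square:
  assumes K: "imag_unit K" and a: "a < n"
  shows "\<Theta> K a * \<Theta> K a = 0"
proof -
  have "\<Theta> K a * \<Theta> K a = - (\<Theta> K a * \<Theta> K a)"
    using \<Theta>_\<Theta>[OF K K a a] unfolding acomm_def .
  then have "\<Theta> K a * \<Theta> K a + \<Theta> K a * \<Theta> K a = 0" by (simp only: eq_neg_iff_add_eq_0)
  then show ?thesis by (rule torsion_free)
qed

lemma anticommuting_\<Theta>: "imag_unit K \<Longrightarrow> anticommuting n (\<Theta> K)"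
  unfolding anticommuting_def by (blast intro: \<Theta>_\<Theta> \<Theta>_square)

lemma comm_\<Theta>:
  assumes "imag_unit K" "\<And>i. i < 2 * n \<Longrightarrow> comm (\<psi> i) w" "a < n"
  shows "comm (\<Theta> K a) w"
  unfolding \<Theta>_def
  by (rule comm_sym, intro comm_lin assms(1); rule comm_sym, rule assms(2)) (use assms(3) in simp_all)

lemma \<Theta>_Zc: "\<lbrakk>imag_unit K; imag_unit L; a < n; b < n; c < n\<rbrakk> \<Longrightarrow> comm (\<Theta> K a) (Zc L b c)"
  unfolding Zc_def by (intro comm_\<Theta> comm_lin \<psi>_X \<psi>_Y)

lemma \<Theta>_Dc: "\<lbrakk>imag_unit K; imag_unit L; a < n; b < n; c < n\<rbrakk> \<Longrightarrow> comm (\<Theta> K a) (Dc L b c)"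
  unfolding Dc_def by (intro comm_\<Theta> comm_lin \<psi>_U \<psi>_V)

lemma Zc_Zc: "\<lbrakk>imag_unit K; imag_unit L; a < n; b < n; c < n; d < n\<rbrakk> \<Longrightarrow> comm (Zc K a b) (Zc L c d)"
  unfolding Zc_def by (intro comm_lin_lin X_X X_Y Y_Y comm_sym[OF X_Y])

lemma Dc_Dc: "\<lbrakk>imag_unit K; imag_unit L; a < n; b < n; c < n; d < n\<rbrakk> \<Longrightarrow> comm (Dc K a b) (Dc L c d)"
  unfolding Dc_def by (intro comm_lin_lin U_U U_V V_V comm_sym[OF U_V])

text \<open>
  The coefficient \<open>h - K * L * h\<close> is \<open>1\<close> for \<open>L = K\<close> and \<open>0\<close> for \<open>L = - K\<close>:
  holomorphic derivatives annihilate antiholomorphic coordinates, and conversely.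
\<close>

lemma Dc_Zc:
  assumes K: "imag_unit K" and L: "imag_unit L" and ix: "a < n" "b < n" "c < n" "d < n"
  shows "Dc K b c * Zc L a d
    = Zc L a d * Dc K b c + (if a = b \<and> c = d then h - K * L * h else 0)"
proof -
  have cK: "w * (K * z) = K * (w * z)" and cL: "w * (L * z) = L * (w * z)" for w z
    using K L by (auto intro!: mult_left_commute_central comm_sym[OF imag_unit_comm])
  have [simp]: "U c b * Y a d = Y a d * U c b" "V c b * X a d = X a d * V c b"
    using U_Y[of c b a d] V_X[of c b a d] ix by (simp_all add: comm_def)
  show ?thesis
    unfolding Dc_def Zc_def
    by (simp add: distrib_left distrib_right mult.assoc
        cL[of "U c b"] cL[of "V c b"] cK[of "X a d"] cK[of "Y a d"] cL[of K]
        U_X[OF ix(1,2,3,4)] V_Y[OF ix(1,2,3,4)] right_diff_distrib)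
qed

lemma imag_unit_square: "imag_unit K \<Longrightarrow> K * K = - 1"
  using I(2) minus_I(2) by (auto simp: imag_unit_def)

text \<open>
  The two choices in either order, for statements about a matrix and its conjugate.
\<close>

definition conj_pair :: "'a \<Rightarrow> 'a \<Rightarrow> bool" where
  "conj_pair K L \<longleftrightarrow> K = I \<and> L = - I \<or> K = - I \<and> L = I"

lemma conj_pair_simps: "conj_pair I (- I)" "conj_pair (- I) I" by (simp_all add: conj_pair_def)

lemma conj_pairD: assumes "conj_pair K L" shows "imag_unit K" "imag_unit L" "K * L = 1" "conj_pair L K"
  using assms I(2) by (auto simp: conj_pair_def imag_unit_def)

lemma complex_capelli:
  assumes K: "imag_unit K"
  shows "capelli n (\<Theta> K) (Zc K) (Dc K)"
proof
  fix a b c d assume "a < n" "b < n" "c < n" "d < n"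
  then have "Dc K b c * Zc K a d
    = Zc K a d * Dc K b c + (if a = b \<and> c = d then h - K * K * h else 0)"
    by (rule Dc_Zc[OF K K])
  then show "Dc K b c * Zc K a d = Zc K a d * Dc K b c + (if a = b \<and> c = d then 1 else 0)"
    by (simp only: imag_unit_square[OF K] mult_minus_left mult_1_left diff_minus_eq_add h(2))
qed (fact torsion_free anticommuting_\<Theta>[OF K] \<Theta>_Zc[OF K K] \<Theta>_Dc[OF K K] Zc_Zc[OF K K] Dc_Dc[OF K K])+

lemma Dc_Zc_conj_pair:
  assumes "conj_pair K L" "a < n" "b < n" "c < n" "d < n"
  shows "comm (Dc K b c) (Zc L a d)"
  using Dc_Zc[OF conj_pairD(1,2)[OF assms(1)] assms(2-5)] conj_pairD(3)[OF assms(1)] by (simp add: comm_def)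

lemma \<psi>_even: "\<psi> (2 * a) = h * (\<Theta> I a + \<Theta> (- I) a)"
proof -
  have "\<Theta> I a + \<Theta> (- I) a = \<psi> (2 * a) + \<psi> (2 * a)" by (simp add: \<Theta>_def)
  then show ?thesis using h(2) by (metis distrib_left distrib_right mult_1_left)
qed

lemma \<psi>_odd: "\<psi> (2 * a + 1) = h * I * (\<Theta> (- I) a - \<Theta> I a)"
proof -
  have "I * (\<Theta> (- I) a - \<Theta> I a) = \<psi> (2 * a + 1) + \<psi> (2 * a + 1)"
    using I(2) by (simp add: \<Theta>_def right_diff_distrib mult.assoc[symmetric])
  then show ?thesis using h(2) by (metis distrib_left distrib_right mult_1_left mult.assoc)
qed

text \<open>The columns of the complex matrix \<open>R + K J\<close>.\<close>

definition col_sum :: "(nat \<Rightarrow> nat \<Rightarrow> 'a) \<Rightarrow> (nat \<Rightarrow> nat \<Rightarrow> 'a) \<Rightarrow> 'a \<Rightarrow> nat \<Rightarrow> 'a" where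
  "col_sum R J K b = (\<Sum>a<n. \<Theta> K a * (R a b + K * J a b))"

lemma col_sum_eq:
  assumes "imag_unit K"
  shows "col_sum R J K b = (\<Sum>i<2 * n. \<psi> i * rform R J i (2 * b))
    + K * (\<Sum>i<2 * n. \<psi> i * rform R J i (2 * b + 1))"
proof -
  have cK: "w * (K * z) = K * (w * z)" for w z
    using assms by (intro mult_left_commute_central comm_sym[OF imag_unit_comm])
  have KK: "K * (K * z) = - z" for z
    using imag_unit_square[OF assms] by (simp add: mult.assoc[symmetric])
  have "\<Theta> K a * (R a b + K * J a b)
     = (\<psi> (2 * a) * R a b - \<psi> (2 * a + 1) * J a b) + K * (\<psi> (2 * a) * J a b + \<psi> (2 * a + 1) * R a b)" for a
    by (simp add: \<Theta>_def distrib_left distrib_right mult.assoc cK[of "\<psi> (2 * a)"]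
        cK[of "\<psi> (Suc (2 * a))"] KK)
  then show ?thesis
    by (simp add: col_sum_def sum_pairs sum.distrib sum_distrib_left[symmetric] sum_subtractf[symmetric])
qed

lemma columns_rform:
  "(\<Sum>i<2 * n. \<psi> i * rform R J i (2 * b)) = h * (col_sum R J I b + col_sum R J (- I) b)"
  "(\<Sum>i<2 * n. \<psi> i * rform R J i (2 * b + 1)) = h * I * (col_sum R J (- I) b - col_sum R J I b)"
proof -
  define p q where "p = (\<Sum>i<2 * n. \<psi> i * rform R J i (2 * b))"
    and "q = (\<Sum>i<2 * n. \<psi> i * rform R J i (2 * b + 1))"
  have col_sum: "col_sum R J I b = p + I * q" "col_sum R J (- I) b = p - I * q"
    by (simp_all add: col_sum_eq[OF imag_unit_simps(1)] col_sum_eq[OF imag_unit_simps(2)] p_def q_def)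
  have hh: "h * z + h * z = z" for z using h(2) by (metis distrib_right mult_1_left)
  have II: "I * (I * z) = - z" for z using I(2) by (simp add: mult.assoc[symmetric])
  show "p = h * (col_sum R J I b + col_sum R J (- I) b)" using hh[of p] by (simp add: col_sum distrib_left)
  show "q = h * I * (col_sum R J (- I) b - col_sum R J I b)"
    using hh[of q] by (simp add: col_sum distrib_left right_diff_distrib mult.assoc II)
qed

lemma oprod_interleave_scaled:
  assumes "\<And>b c. b < n \<Longrightarrow> c < n \<Longrightarrow> acomm (v b) (u c)"
  shows "oprod (\<lambda>b. h * I * (u b * v b)) n
    = (h * I) ^ n * ((- 1) ^ (n choose 2) * (oprod u n * oprod v n))"
proof -
  have "comm (h * I) w" for w using h(1) I(1) comm_mult_left by blast
  then show ?thesis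
    using oprod_interleave[OF assms] by (subst oprod_central) simp_all
qed

text \<open>
  For commuting entries this says that the determinant of the real form is the product of the
  determinants of \<open>R + I J\<close> and \<open>R - I J\<close>, in terms of columns.
\<close>

lemma rform_commuting:
  assumes RR: "\<And>a b c d. \<lbrakk>a < n; b < n; c < n; d < n\<rbrakk> \<Longrightarrow> comm (R a b) (R c d)"
    and RJ: "\<And>a b c d. \<lbrakk>a < n; b < n; c < n; d < n\<rbrakk> \<Longrightarrow> comm (R a b) (J c d)"
    and JJ: "\<And>a b c d. \<lbrakk>a < n; b < n; c < n; d < n\<rbrakk> \<Longrightarrow> comm (J a b) (J c d)"
    and \<psi>_R: "\<And>i b c. \<lbrakk>i < 2 * n; b < n; c < n\<rbrakk> \<Longrightarrow> comm (\<psi> i) (R b c)"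
    and \<psi>_J: "\<And>i b c. \<lbrakk>i < 2 * n; b < n; c < n\<rbrakk> \<Longrightarrow> comm (\<psi> i) (J b c)"
  shows "oprod \<psi> (2 * n) * cdet (2 * n) (rform R J)
    = (h * I) ^ n * ((- 1) ^ (n choose 2) * (oprod (col_sum R J I) n * oprod (col_sum R J (- I)) n))"
proof -
  have \<psi>_rform: "comm (\<psi> a) (rform R J i j)" if "a < 2 * n" "i < 2 * n" "j < 2 * n" for a i j
    using that by (auto simp: rform_def intro!: comm_uminus \<psi>_R \<psi>_J)
  have \<Theta>_RJ: "comm (\<Theta> K a) (R b c + L * J b c)"
    if "imag_unit K" "imag_unit L" "a < n" "b < n" "c < n" for K L a b c
    using that by (intro comm_\<Theta> comm_lin \<psi>_R \<psi>_J)
  have RJ_RJ: "comm (R a b + K * J a b) (R c d + L * J c d)"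
    if "imag_unit K" "imag_unit L" "a < n" "b < n" "c < n" "d < n" for K L a b c d
    using that by (intro comm_lin_lin RR RJ JJ comm_sym[OF RJ])
  have \<Theta>_col_sum: "acomm (\<Theta> K a) (col_sum R J L b)" if "imag_unit K" "imag_unit L" "a < n" "b < n" for K L a b
    unfolding col_sum_def using that by (intro acomm_sum acomm_mult_comm \<Theta>_\<Theta> \<Theta>_RJ) auto
  have RJ_col_sum: "comm (R a b + K * J a b) (col_sum R J L c)"
    if "imag_unit K" "imag_unit L" "a < n" "b < n" "c < n" for K L a b c
    unfolding col_sum_def using that by (intro comm_sum comm_mult RJ_RJ comm_sym[OF \<Theta>_RJ]) auto
  have col_sum_col_sum: "acomm (col_sum R J K b) (col_sum R J L c)" if "imag_unit K" "imag_unit L" "b < n" "c < n" for K L b c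
    unfolding col_sum_def[of R J L]
    using that by (intro acomm_sum acomm_mult_comm acomm_sym[OF \<Theta>_col_sum] comm_sym[OF RJ_col_sum]) auto
  have col_sum_square: "col_sum R J K b * col_sum R J K b = 0" if "imag_unit K" "b < n" for K b
  proof (rule torsion_free)
    show "col_sum R J K b * col_sum R J K b + col_sum R J K b * col_sum R J K b = 0"
      using col_sum_col_sum[OF that(1,1,2,2)] by (simp only: acomm_def eq_neg_iff_add_eq_0)
  qed
  have "oprod \<psi> (2 * n) * cdet (2 * n) (rform R J) = oprod (\<lambda>j. \<Sum>i<2 * n. \<psi> i * rform R J i j) (2 * n)"
    by (rule oprod_columns[OF \<psi> \<psi>_rform, symmetric])
  also have "\<dots> = oprod (\<lambda>b. h * (col_sum R J I b + col_sum R J (- I) b) * (h * I * (col_sum R J (- I) b - col_sum R J I b))) n"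
    unfolding oprod_pairs columns_rform ..
  also have "\<dots> = oprod (\<lambda>b. h * I * (col_sum R J I b * col_sum R J (- I) b)) n"
  proof (rule oprod_cong)
    fix b assume b: "b < n"
    show "h * (col_sum R J I b + col_sum R J (- I) b) * (h * I * (col_sum R J (- I) b - col_sum R J I b))
       = h * I * (col_sum R J I b * col_sum R J (- I) b)"
      using two_columns[OF I h col_sum_col_sum[OF imag_unit_simps b b], of 0] col_sum_square[OF imag_unit_simps(1) b]
        col_sum_square[OF imag_unit_simps(2) b] by simp
  qed
  also have "\<dots> = (h * I) ^ n * ((- 1) ^ (n choose 2) * (oprod (col_sum R J I) n * oprod (col_sum R J (- I)) n))"
    by (intro oprod_interleave_scaled col_sum_col_sum imag_unit_simps)
  finally show ?thesis .
qed

text \<open>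
  Real and imaginary part of the product \<open>(X + I Y) (U + I V)\<close>.
\<close>

definition P :: "nat \<Rightarrow> nat \<Rightarrow> 'a" where
  "P a b = (\<Sum>c<n. X a c * U c b - Y a c * V c b)"
definition Q :: "nat \<Rightarrow> nat \<Rightarrow> 'a" where
  "Q a b = (\<Sum>c<n. X a c * V c b + Y a c * U c b)"

lemma rform_mult: "(\<Sum>l<2 * n. rform X Y i l * rform U V l j) = rform P Q i j"
  unfolding sum_pairs
  by (cases "even i"; cases "even j")
    (simp_all add: rform_def P_def Q_def sum_negf[symmetric] algebra_simps)

lemma P_Q:
  assumes K: "imag_unit K"
  shows "P a b + K * Q a b = (\<Sum>c<n. Zc K a c * Dc K b c)"
proof -
  have cK: "w * (K * z) = K * (w * z)" for w z
    using K by (intro mult_left_commute_central comm_sym[OF imag_unit_comm])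
  have KK: "K * (K * z) = - z" for z
    using imag_unit_square[OF K] by (simp add: mult.assoc[symmetric])
  show ?thesis
    by (simp add: P_def Q_def sum_distrib_left sum.distrib[symmetric] Zc_def Dc_def distrib_left
      distrib_right mult.assoc cK[of "X a _"] cK[of "Y a _"] KK algebra_simps)
qed

text \<open>
  The columns \<open>H b\<close> of the Capelli identity, with the shift that belongs to the position \<open>b\<close>.
\<close>

definition shifted_col :: "'a \<Rightarrow> nat \<Rightarrow> 'a" where
  "shifted_col K b = col_sum P Q K b + of_int (int n - 1 - int b) * \<Theta> K b"

lemma shifted_col: "imag_unit K \<Longrightarrow> shifted_col K b = capelli.H n (\<Theta> K) (Zc K) (Dc K) (int n - 1 - int b) b"
proof -
  assume K: "imag_unit K"
  interpret c: capelli n "\<Theta> K" "Zc K" "Dc K" using complex_capelli[OF K] .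
  have "col_sum P Q K b = (\<Sum>a<n. \<Sum>c<n. \<Theta> K a * (Zc K a c * Dc K b c))"
    by (simp add: col_sum_def P_Q[OF K] sum_distrib_left)
  also have "\<dots> = c.\<eta> b"
    by (subst sum.swap) (simp add: c.\<eta>_def c.\<zeta>_def sum_distrib_right mult.assoc)
  finally show ?thesis by (simp add: shifted_col_def c.H_def)
qed

lemma \<Theta>_PQ: "\<lbrakk>imag_unit K; imag_unit L; a < n; b < n; c < n\<rbrakk> \<Longrightarrow> comm (\<Theta> L a) (P b c + K * Q b c)"
  by (simp only: P_Q, intro comm_sum comm_mult \<Theta>_Zc \<Theta>_Dc) simp_all

lemma \<Theta>_col_sum: "\<lbrakk>imag_unit K; imag_unit L; a < n; b < n\<rbrakk> \<Longrightarrow> acomm (\<Theta> L a) (col_sum P Q K b)"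
  unfolding col_sum_def by (intro acomm_sum acomm_mult_comm \<Theta>_\<Theta> \<Theta>_PQ) simp_all

lemma \<Theta>_shifted_col: "\<lbrakk>imag_unit K; imag_unit L; a < n; b < n\<rbrakk> \<Longrightarrow> acomm (\<Theta> L a) (shifted_col K b)"
  unfolding shifted_col_def by (intro acomm_add acomm_comm_mult comm_of_int \<Theta>_\<Theta> \<Theta>_col_sum)

lemma Zc_PQ_conj_pair:
  assumes "conj_pair K L" "a < n" "b < n" "c < n" "d < n"
  shows "comm (Zc K a b) (P c d + L * Q c d)"
  unfolding P_Q[OF conj_pairD(2)[OF assms(1)]]
  by (intro comm_sum comm_mult Zc_Zc comm_sym[OF Dc_Zc_conj_pair] conj_pairD[OF assms(1)] assms) (use assms in auto)

lemma Dc_PQ_conj_pair: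
  assumes "conj_pair K L" "a < n" "b < n" "c < n" "d < n"
  shows "comm (Dc K a b) (P c d + L * Q c d)"
  unfolding P_Q[OF conj_pairD(2)[OF assms(1)]]
  by (intro comm_sum comm_mult Dc_Dc Dc_Zc_conj_pair conj_pairD[OF assms(1)] assms) (use assms in auto)

lemma PQ_PQ_conj_pair:
  assumes "conj_pair K L" "a < n" "b < n" "c < n" "d < n"
  shows "comm (P a b + K * Q a b) (P c d + L * Q c d)"
  unfolding P_Q[OF conj_pairD(1)[OF assms(1)]]
  by (rule comm_sym, intro comm_sum comm_mult comm_sym[OF Zc_PQ_conj_pair] comm_sym[OF Dc_PQ_conj_pair] assms)
    (use assms in auto)

lemma shifted_col_shifted_col:
  assumes conj_pair: "conj_pair K L" and b: "b < n" and c: "c < n"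
  shows "acomm (shifted_col K b) (shifted_col L c)"
proof -
  note imag_unit = conj_pairD(1,2)[OF conj_pair]
  have *: "comm (P d e + L * Q d e) (col_sum P Q K b)" if "d < n" "e < n" for d e
    unfolding col_sum_def
    by (intro comm_sum comm_mult comm_sym[OF \<Theta>_PQ] comm_sym[OF PQ_PQ_conj_pair] conj_pair imag_unit) (use that b in auto)
  have **: "comm (P d e + L * Q d e) (shifted_col K b)" if "d < n" "e < n" for d e
    unfolding shifted_col_def
    by (intro comm_add comm_mult comm_of_int * comm_sym[OF \<Theta>_PQ] imag_unit that b)
  have "acomm (shifted_col K b) (col_sum P Q L c)"
    unfolding col_sum_def
    by (intro acomm_sum acomm_mult_comm acomm_sym[OF \<Theta>_shifted_col] comm_sym[OF **] imag_unit) (use b c in auto)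
  then show ?thesis
    unfolding shifted_col_def[of L]
    by (intro acomm_add acomm_comm_mult comm_of_int acomm_sym[OF \<Theta>_shifted_col] imag_unit b c)
qed

lemma shifted_col_square: "b < n \<Longrightarrow> shifted_col I b * shifted_col I b = - (\<Theta> I b * shifted_col I b)"
proof -
  assume b: "b < n"
  interpret c: capelli n "\<Theta> I" "Zc I" "Dc I" using complex_capelli[OF imag_unit_simps(1)] .
  show ?thesis unfolding shifted_col[OF imag_unit_simps(1)] by (rule c.H_H[OF b])
qed

text \<open>
  The entries of the correction matrix are chosen so that its columns shift the two complex columns
  by \<open>n - 1 - b\<close> and add one and the same multiple of \<open>\<Theta> I b\<close>, up to a factor \<open>I\<close>.
\<close>

lemma columns_tform:
  assumes b: "b < n"
  shows "(\<Sum>i<2 * n. \<psi> i * (rform P Q i (2 * b) + tform n (h * h) I i (2 * b)))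
      = h * (shifted_col I b + shifted_col (- I) b + h * \<Theta> I b)" (is ?A)
    and "(\<Sum>i<2 * n. \<psi> i * (rform P Q i (2 * b + 1) + tform n (h * h) I i (2 * b + 1)))
      = h * I * (shifted_col (- I) b - shifted_col I b + h * \<Theta> I b)" (is ?B)
proof -
  define k where "k = int n - 1 - int b"
  let ?k = "of_int k :: 'a"
  have ck: "x * ?k = ?k * x" for x using comm_of_int[of x] by (simp add: comm_def)
  have cq: "x * (h * h) = h * (h * x)" for x using h(1)[of x] by (metis comm_def mult.assoc)
  have cI: "x * (I * y) = I * (x * y)" for x y by (rule mult_left_commute_central[OF I(1)])
  have chk: "h * (?k * x) = ?k * (h * x)" for x using ck[of h] by (simp add: mult.assoc[symmetric])
  have cIk: "I * (?k * x) = ?k * (I * x)" for x using ck[of I] by (simp add: mult.assoc[symmetric])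
  have II: "I * (I * x) = - x" for x using I(2) by (simp add: mult.assoc[symmetric])
  have 1: "(\<Sum>i<2 * n. \<psi> i * tform n (h * h) I i (2 * b)) = ?k * \<psi> (2 * b) + h * (h * \<Theta> I b)"
  proof -
    have "(\<Sum>i<2 * n. \<psi> i * tform n (h * h) I i (2 * b))
        = (\<Sum>a<n. if a = b then \<psi> (2 * b) * (?k + h * h) + \<psi> (2 * b + 1) * (I * (h * h)) else 0)"
      unfolding sum_pairs by (intro sum.cong refl) (auto simp: k_def)
    also have "\<dots> = \<psi> (2 * b) * (?k + h * h) + \<psi> (2 * b + 1) * (I * (h * h))" using b by simp
    also have "\<dots> = ?k * \<psi> (2 * b) + h * (h * \<Theta> I b)"
      by (simp add: \<Theta>_def distrib_left ck[of "\<psi> _"] cq[of "\<psi> _"] cI[of "\<psi> _"] cI[of h])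
    finally show ?thesis .
  qed
  have 2: "(\<Sum>i<2 * n. \<psi> i * tform n (h * h) I i (2 * b + 1)) = ?k * \<psi> (2 * b + 1) + h * I * (h * \<Theta> I b)"
  proof -
    have "(\<Sum>i<2 * n. \<psi> i * tform n (h * h) I i (2 * b + 1))
        = (\<Sum>a<n. if a = b then \<psi> (2 * b) * (I * (h * h)) + \<psi> (2 * b + 1) * (?k - h * h) else 0)"
      unfolding sum_pairs by (intro sum.cong refl) (auto simp: k_def)
    also have "\<dots> = \<psi> (2 * b) * (I * (h * h)) + \<psi> (2 * b + 1) * (?k - h * h)" using b by simp
    also have "\<dots> = ?k * \<psi> (2 * b + 1) + h * I * (h * \<Theta> I b)"
      by (simp add: \<Theta>_def distrib_left right_diff_distrib ck[of "\<psi> _"] cq[of "\<psi> _"] cI[of "\<psi> _"] cI[of h] II mult.assoc)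
    finally show ?thesis .
  qed
  show ?A
    unfolding distrib_left sum.distrib columns_rform 1
    by (simp add: shifted_col_def k_def[symmetric] \<psi>_even distrib_left chk)
  show ?B
    unfolding distrib_left sum.distrib columns_rform 2 
    unfolding \<psi>_odd
    by (simp add: shifted_col_def k_def[symmetric] distrib_left right_diff_distrib mult.assoc chk cIk)
qed

lemma real_capelli_identity:
  "oprod \<psi> (2 * n) * cdet (2 * n)
     (\<lambda>i j. (\<Sum>l<2 * n. rform X Y i l * rform U V l j) + tform n (h * h) I i j)
   = oprod \<psi> (2 * n) * (cdet (2 * n) (rform X Y) * cdet (2 * n) (rform U V))"
proof -
  interpret c: capelli n "\<Theta> I" "Zc I" "Dc I" using complex_capelli[OF imag_unit_simps(1)] .
  interpret c': capelli n "\<Theta> (- I)" "Zc (- I)" "Dc (- I)" using complex_capelli[OF imag_unit_simps(2)] .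
  let ?s = "\<lambda>w. (h * I) ^ n * ((- 1) ^ (n choose 2) * w)"
  define e e' where "e = cdet n (\<lambda>c b. Dc I b c)" and "e' = cdet n (\<lambda>c b. Dc (- I) b c)"
  have \<psi>_rform: "comm (\<psi> i) (rform X Y j l)" "comm (\<psi> i) (rform U V j l)"
    if "i < 2 * n" "j < 2 * n" "l < 2 * n" for i j l
    using that by (auto simp: rform_def intro!: comm_uminus \<psi>_X \<psi>_Y \<psi>_U \<psi>_V)
  have \<psi>_tform: "comm (\<psi> i) (tform n (h * h) I j l)" for i j l
    unfolding tform_def
    by (intro comm_if comm_intros comm_0 comm_sym[OF h(1)] comm_sym[OF I(1)])
  have \<psi>_full: "comm (\<psi> i) ((\<Sum>l<2 * n. rform X Y j l * rform U V l m) + tform n (h * h) I j m)"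
    if "i < 2 * n" "j < 2 * n" "m < 2 * n" for i j m
    using that by (intro comm_add comm_sum comm_mult \<psi>_tform \<psi>_rform) auto
  have e_\<Theta>: "comm (\<Theta> K b) e" "comm (\<Theta> K b) e'" if "imag_unit K" "b < n" for K b
    unfolding e_def e'_def using that by (auto intro!: comm_cdet \<Theta>_Dc imag_unit_simps)
  have e_\<zeta>': "comm e (c'.\<zeta> b)" if "b < n" for b
    unfolding c'.\<zeta>_def
  proof (intro comm_sum comm_mult)
    fix a assume "a \<in> {..<n}"
    then show "comm e (\<Theta> (- I) a)" using e_\<Theta>(1)[OF imag_unit_simps(2)] comm_sym by auto
    show "comm e (Zc (- I) a b)"
      unfolding e_def
      by (rule comm_sym, intro comm_cdet comm_sym[OF Dc_Zc_conj_pair[OF conj_pair_simps(1)]])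
        (use \<open>a \<in> _\<close> that in auto)
  qed

  have swap_mid: "u * (e * (v * w)) = u * (v * (e * w))" if "comm e v" for u v w
    using that by (simp add: comm_def mult.assoc[symmetric])
  have "oprod \<psi> (2 * n) * cdet (2 * n)
     (\<lambda>i j. (\<Sum>l<2 * n. rform X Y i l * rform U V l j) + tform n (h * h) I i j)
    = oprod (\<lambda>j. \<Sum>i<2 * n. \<psi> i * ((\<Sum>l<2 * n. rform X Y i l * rform U V l j) + tform n (h * h) I i j)) (2 * n)"
    by (rule oprod_columns[OF \<psi> \<psi>_full, symmetric])
  also have "\<dots> = oprod (\<lambda>b. h * I * (shifted_col I b * shifted_col (- I) b) + h * (h * I) * (shifted_col (- I) b * shifted_col (- I) b)) n"
    unfolding oprod_pairs rform_mult
  proof (rule oprod_cong)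
    fix b assume b: "b < n"
    show "(\<Sum>i<2 * n. \<psi> i * (rform P Q i (2 * b) + tform n (h * h) I i (2 * b))) *
      (\<Sum>i<2 * n. \<psi> i * (rform P Q i (2 * b + 1) + tform n (h * h) I i (2 * b + 1)))
      = h * I * (shifted_col I b * shifted_col (- I) b) + h * (h * I) * (shifted_col (- I) b * shifted_col (- I) b)"
      unfolding columns_tform[OF b]
      by (rule two_columns[OF I h]) (simp_all add: b shifted_col_shifted_col conj_pair_simps acomm_sym[OF \<Theta>_shifted_col] imag_unit_simps
        shifted_col_square \<Theta>_square)
  qed
  \<comment> \<open>squares of antiholomorphic columns exceed the degree that \<open>n\<close> variables allow\<close>
  also have "\<dots> = oprod (\<lambda>b. h * I * (shifted_col I b * shifted_col (- I) b)) n"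
  proof (rule oprod_drop_excess[OF anticommuting_\<Theta>[OF imag_unit_simps(2)]])
    have central: "w * (h * I * z) = h * I * (w * z)" "w * (h * (h * I) * z) = h * (h * I) * (w * z)" for w z
      by (rule mult_left_commute_central, intro comm_mult_left h(1) I(1))+
    have up: "w * shifted_col (- I) b \<in> deg_ge n (\<Theta> (- I)) (Suc j)"
      if "b < n" "w \<in> deg_ge n (\<Theta> (- I)) j" for w j b
    proof -
      have "w * shifted_col (- I) b = (\<Sum>a<n. w * \<Theta> (- I) a * (P a b + - I * Q a b))
          + of_int (int n - 1 - int b) * (w * \<Theta> (- I) b)"
        using mult_of_int_commute[of "int n - 1 - int b" w]
        by (simp add: shifted_col_def col_sum_def distrib_left sum_distrib_left mult.assoc[symmetric])
      also have "\<dots> \<in> deg_ge n (\<Theta> (- I)) (Suc j)"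
        using that by (intro deg_ge_add deg_ge_sum deg_ge_comm deg_ge_lmult deg_ge_gen \<Theta>_PQ imag_unit_simps) auto
      finally show ?thesis .
    qed
    fix w j b assume b: "b < n" and w: "w \<in> deg_ge n (\<Theta> (- I)) j"
    have "w * shifted_col I b \<in> deg_ge n (\<Theta> (- I)) j"
      using b w by (intro deg_ge_acomm \<Theta>_shifted_col imag_unit_simps)
    then have "w * shifted_col I b * shifted_col (- I) b \<in> deg_ge n (\<Theta> (- I)) (Suc j)"
      by (rule up[OF b])
    then show "w * (h * I * (shifted_col I b * shifted_col (- I) b)) \<in> deg_ge n (\<Theta> (- I)) (Suc j)"
      unfolding central mult.assoc[symmetric, of w] by (rule deg_ge_lmult)
    show "w * (h * (h * I) * (shifted_col (- I) b * shifted_col (- I) b)) \<in> deg_ge n (\<Theta> (- I)) (Suc (Suc j))"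
      unfolding central mult.assoc[symmetric, of w] using up[OF b up[OF b w]] by (rule deg_ge_lmult)
  qed
  also have "\<dots> = ?s (oprod (shifted_col I) n * oprod (shifted_col (- I)) n)"
    by (rule oprod_interleave_scaled) (rule shifted_col_shifted_col[OF conj_pair_simps(2)])
  also have "oprod (shifted_col I) n = oprod c.\<zeta> n * e"
    unfolding shifted_col[OF imag_unit_simps(1)] e_def by (rule c.capelli_identity)
  also have "oprod (shifted_col (- I)) n = oprod c'.\<zeta> n * e'"
    unfolding shifted_col[OF imag_unit_simps(2)] e'_def by (rule c'.capelli_identity)
  also have "?s (oprod c.\<zeta> n * e * (oprod c'.\<zeta> n * e')) = ?s (oprod c.\<zeta> n * oprod c'.\<zeta> n) * (e * e')"
    using swap_mid[OF comm_oprod[OF e_\<zeta>']] by (simp only: mult.assoc)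
  also have "?s (oprod c.\<zeta> n * oprod c'.\<zeta> n) = oprod \<psi> (2 * n) * cdet (2 * n) (rform X Y)"
    by (subst rform_commuting[OF X_X X_Y Y_Y \<psi>_X \<psi>_Y])
      (simp_all add: col_sum_def[abs_def] c.\<zeta>_def[abs_def] c'.\<zeta>_def[abs_def] Zc_def)
  finally have 1: "oprod \<psi> (2 * n) * cdet (2 * n)
     (\<lambda>i j. (\<Sum>l<2 * n. rform X Y i l * rform U V l j) + tform n (h * h) I i j)
     = oprod \<psi> (2 * n) * cdet (2 * n) (rform X Y) * (e * e')" .

  \<comment> \<open>the same computation for the derivatives alone; \<open>e\<close> and \<open>e'\<close> are the two complex determinants\<close>
  have "oprod \<psi> (2 * n) * cdet (2 * n) (rform U V) = ?s (oprod (col_sum U V I) n * oprod (col_sum U V (- I)) n)"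
    by (rule rform_commuting[OF U_U U_V V_V \<psi>_U \<psi>_V])
  also have "oprod (col_sum U V I) n = oprod (\<Theta> I) n * e"
    unfolding col_sum_def e_def Dc_def[symmetric]
    by (rule oprod_columns) (auto intro: anticommuting_\<Theta> \<Theta>_Dc imag_unit_simps)
  also have "oprod (col_sum U V (- I)) n = oprod (\<Theta> (- I)) n * e'"
    unfolding col_sum_def e'_def Dc_def[symmetric]
    by (rule oprod_columns) (auto intro: anticommuting_\<Theta> \<Theta>_Dc imag_unit_simps)
  also have "?s (oprod (\<Theta> I) n * e * (oprod (\<Theta> (- I)) n * e'))
      = ?s (oprod (\<Theta> I) n * oprod (\<Theta> (- I)) n) * (e * e')"
    using swap_mid[OF comm_oprod[OF comm_sym[OF e_\<Theta>(1)[OF imag_unit_simps(2)]]]] by (simp only: mult.assoc)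
  also have "?s (oprod (\<Theta> I) n * oprod (\<Theta> (- I)) n) = oprod \<psi> (2 * n)"
  proof -
    have "oprod \<psi> (2 * n) = oprod (\<lambda>b. h * (\<Theta> I b + \<Theta> (- I) b) * (h * I * (\<Theta> (- I) b - \<Theta> I b))) n"
      unfolding oprod_pairs \<psi>_even \<psi>_odd ..
    also have "\<dots> = oprod (\<lambda>b. h * I * (\<Theta> I b * \<Theta> (- I) b)) n"
    proof (rule oprod_cong)
      fix b assume b: "b < n"
      show "h * (\<Theta> I b + \<Theta> (- I) b) * (h * I * (\<Theta> (- I) b - \<Theta> I b)) = h * I * (\<Theta> I b * \<Theta> (- I) b)"
        using two_columns[OF I h \<Theta>_\<Theta>[OF imag_unit_simps b b], of 0] \<Theta>_square[OF imag_unit_simps(1) b]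
          \<Theta>_square[OF imag_unit_simps(2) b] by simp
    qed
    also have "\<dots> = ?s (oprod (\<Theta> I) n * oprod (\<Theta> (- I)) n)"
      by (intro oprod_interleave_scaled \<Theta>_\<Theta> imag_unit_simps)
    finally show ?thesis by simp
  qed
  finally have 2: "oprod \<psi> (2 * n) * cdet (2 * n) (rform U V) = oprod \<psi> (2 * n) * (e * e')" .

  have "comm (oprod \<psi> (2 * n)) (cdet (2 * n) (rform X Y))"
    by (intro comm_cdet comm_sym[OF comm_oprod] comm_sym[OF \<psi>_rform(1)])
  then have 3: "oprod \<psi> (2 * n) * (cdet (2 * n) (rform X Y) * w)
      = cdet (2 * n) (rform X Y) * (oprod \<psi> (2 * n) * w)" for w
    by (simp add: comm_def mult.assoc[symmetric])
  show ?thesis unfolding 1 mult.assoc 3 2 ..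
qed

end


section \<open>A ring with Grassmann variables\<close>

text \<open>
  Families of ring elements indexed by sets of natural numbers form a Fock space. The ring consists
  of its additive endomorphisms that commute with multiplication from the right. Linearity on the
  right makes left multiplication by a central coefficient central in the whole ring.
\<close>

typedef (overloaded) ('a::ring_1) fock = "{F :: (nat set \<Rightarrow> 'a) \<Rightarrow> nat set \<Rightarrow> 'a.
    (\<forall>f g. F (\<lambda>S. f S + g S) = (\<lambda>S. F f S + F g S)) \<and>
    (\<forall>f r. F (\<lambda>S. f S * r) = (\<lambda>S. F f S * r))}"
  morphisms fock_apply Abs_fock
  by (rule exI[of _ id]) simp

setup_lifting type_definition_fock

instantiation fock :: (ring_1) ring_1
begin

lift_definition zero_fock :: "'a fock" is "\<lambda>f S. 0" by simp
lift_definition one_fock :: "'a fock" is id by simp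
lift_definition plus_fock :: "'a fock \<Rightarrow> 'a fock \<Rightarrow> 'a fock" is "\<lambda>F G f S. F f S + G f S"
  by (auto simp: algebra_simps)
lift_definition uminus_fock :: "'a fock \<Rightarrow> 'a fock" is "\<lambda>F f S. - F f S"
  by auto
lift_definition minus_fock :: "'a fock \<Rightarrow> 'a fock \<Rightarrow> 'a fock" is "\<lambda>F G f S. F f S - G f S"
  by (auto simp: algebra_simps)
lift_definition times_fock :: "'a fock \<Rightarrow> 'a fock \<Rightarrow> 'a fock" is "\<lambda>F G. F \<circ> G"
  by auto

instance
proof
  show "(0 :: 'a fock) \<noteq> 1"
  proof transfer
    show "(\<lambda>f S. 0) \<noteq> (id :: (nat set \<Rightarrow> 'a) \<Rightarrow> nat set \<Rightarrow> 'a)"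
      by (metis id_apply zero_neq_one)
  qed
qed (transfer; auto simp: fun_eq_iff algebra_simps)+

end

text \<open>
  Left multiplication by a coefficient, and the creation operators. The exponent counts the
  variables in \<open>S\<close> that precede \<open>i\<close>, which makes the creation operators anticommute.
\<close>

lift_definition emb :: "'a::ring_1 \<Rightarrow> 'a fock" is "\<lambda>r f S. r * f S"
  by (auto simp: algebra_simps)

lift_definition create :: "nat \<Rightarrow> 'a::ring_1 fock"
  is "\<lambda>i f S. if i \<in> S then (- 1) ^ card {j \<in> S. j < i} * f (S - {i}) else 0"
  by (auto simp: fun_eq_iff algebra_simps)

lemma emb_add: "emb (a + b) = emb a + emb b"
  and emb_uminus: "emb (- a) = - emb a"
  and emb_diff: "emb (a - b) = emb a - emb b"
  and emb_mult: "emb (a * b) = emb a * emb b"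
  and emb_0: "emb 0 = 0"
  and emb_1: "emb 1 = 1"
  by (transfer; simp add: fun_eq_iff algebra_simps)+

lemma emb_of_nat: "emb (of_nat k) = of_nat k"
  by (induction k) (simp_all add: emb_0 emb_1 emb_add)

lemma emb_of_int: "emb (of_int k) = of_int k"
  by (cases k) (simp_all add: emb_of_nat emb_uminus emb_1 emb_diff emb_add)

lemma emb_sum: "emb (\<Sum>i\<in>S. f i) = (\<Sum>i\<in>S. emb (f i))"
  by (induction S rule: infinite_finite_induct) (simp_all add: emb_0 emb_add)

lemma emb_oprod: "emb (oprod u k) = oprod (\<lambda>i. emb (u i)) k"
  by (induction k) (simp_all add: emb_1 emb_mult oprod_Suc)

lemma emb_cdet: "emb (cdet N M) = cdet N (\<lambda>i j. emb (M i j))"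
  by (simp add: cdet_def emb_sum emb_mult emb_of_int emb_oprod)

lemma comm_create_emb: "comm (create i) (emb r)"
  unfolding comm_def
  by transfer (auto simp: fun_eq_iff mult.assoc[symmetric] minus_one_power_commute)

lemma comm_emb: "comm a b \<Longrightarrow> comm (emb a) (emb b)"
  unfolding comm_def by (simp add: emb_mult[symmetric])

lemma comm_emb_central:
  assumes "\<And>r. c * r = r * c"
  shows "comm (emb c) w"
  unfolding comm_def using assms
proof (transfer, elim CollectE conjE)
  fix c :: 'a and w :: "(nat set \<Rightarrow> 'a) \<Rightarrow> nat set \<Rightarrow> 'a"
  assume c: "\<And>r. c * r = r * c" and w: "\<forall>f r. w (\<lambda>S. f S * r) = (\<lambda>S. w f S * r)"
  have "w (\<lambda>S. c * f S) = (\<lambda>S. c * w f S)" for f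
    using w by (simp add: c)
  then show "(\<lambda>f S. c * f S) \<circ> w = w \<circ> (\<lambda>f S. c * f S)" by (simp add: fun_eq_iff)
qed

lemma anticommuting_create: "anticommuting N create"
  unfolding anticommuting_def
proof (intro conjI allI impI)
  fix i j
  show "create i * create i = (0 :: 'a fock)" by transfer (simp add: fun_eq_iff)
  have card_less: "card {k \<in> S. k < j} = Suc (card {k \<in> S - {i}. k < j})"
    "{k \<in> S - {j}. k < i} = {k \<in> S. k < i}" if "i < j" "i \<in> S" for S and i j :: nat
  proof -
    have "{k \<in> S. k < j} = insert i {k \<in> S - {i}. k < j}" using that by auto
    moreover have "finite {k \<in> S - {i}. k < j}" by (rule finite_subset[of _ "{..<j}"]) auto
    ultimately show "card {k \<in> S. k < j} = Suc (card {k \<in> S - {i}. k < j})" by simp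
    show "{k \<in> S - {j}. k < i} = {k \<in> S. k < i}" using that by auto
  qed
  have *: "create i * create j = - (create j * create i :: 'a fock)" if "i < j" for i j
    using that
  proof transfer
    fix i j :: nat assume ij: "i < j"
    let ?F = "\<lambda>i (f :: nat set \<Rightarrow> 'a) S. if i \<in> S then (- 1) ^ card {j \<in> S. j < i} * f (S - {i}) else 0"
    have "?F i (?F j f) S = - ?F j (?F i f) S" for f S
    proof (cases "i \<in> S \<and> j \<in> S")
      case True
      have "S - {i} - {j} = S - {j} - {i}" by auto
      then show ?thesis
        using True ij card_less[OF ij, of S] 
        by (simp add: mult.assoc[symmetric] power_add[symmetric] add.commute)
    qed (use ij in auto)
    then show "?F i \<circ> ?F j = (\<lambda>f S. - (?F j \<circ> ?F i) f S)" by (simp add: fun_eq_iff)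
  qed
  consider "i < j" | "i = j" | "j < i" by linarith
  then show "acomm (create i) (create j :: 'a fock)"
  proof cases
    case 2
    have "create i * create i = (0 :: 'a fock)" by transfer (simp add: fun_eq_iff)
    then show ?thesis using 2 by (simp add: acomm_def)
  next
    case 3
    then show ?thesis by (intro acomm_sym[of "create j"]) (simp only: acomm_def *)
  qed (simp only: acomm_def *)
qed

lemma fock_apply_simps:
  "fock_apply (F * G) f = fock_apply F (fock_apply G f)" "fock_apply 1 f = f"
  "fock_apply (create i) f S = (if i \<in> S then (- 1) ^ card {j \<in> S. j < i} * f (S - {i}) else 0)"
  "fock_apply (emb r) f S = r * f S"
  by (transfer; simp)+

lemma prod_create_apply:
  "i \<le> N \<Longrightarrow> fock_apply (prod_list (map create [i..<N])) f {i..<N} = f {}"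
proof (induction i rule: inc_induct)
  case (step i)
  have none: "(i \<le> j \<and> j < N \<and> j < i) = False" for j by auto
  have "{i..<N} - {i} = {Suc i..<N}" by auto
  moreover have "[i..<N] = i # [Suc i..<N]" using step by (simp add: upt_conv_Cons)
  ultimately show ?case using step by (simp add: fock_apply_simps none del: upt_Suc)
qed (simp add: fock_apply_simps)

text \<open>
  The coefficient is read off at the set \<open>{0..<N}\<close> after application to a family that takes the value
  \<open>1\<close> at the empty set.
\<close>

lemma oprod_create_cancel:
  assumes "oprod create N * emb r = oprod create N * emb s"
  shows "r = s"
proof -
  have "fock_apply (oprod create N * emb r) (\<lambda>S. 1) {0..<N} = r" for r :: 'a
    using prod_create_apply[of 0 N "fock_apply (emb r) (\<lambda>S. 1)"]
    by (simp add: oprod_def fock_apply_simps)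
  then show ?thesis using assms by metis
qed


section \<open>Weyl relations\<close>

lemma poly_additive_eqI:
  fixes F G :: "'v cpoly \<Rightarrow> 'v cpoly"
  assumes F: "\<And>p q. F (p + q) = F p + F q" and G: "\<And>p q. G (p + q) = G p + G q"
    and single: "\<And>m c. F (Poly_Mapping.single m c) = G (Poly_Mapping.single m c)"
  shows "F p = G p"
proof (induction p rule: update_induct)
  case const
  show ?case using single[of 0 0] by simp
next
  case (update p m c)
  have "Poly_Mapping.update m c p = p + Poly_Mapping.single m c"
    using update(1) by (intro poly_mapping_eqI)
      (auto simp: lookup_update lookup_add lookup_single when_def in_keys_iff)
  then show ?case using update by (simp add: F G single)
qed

lemma lookup_poly_const_mult:
  "Poly_Mapping.lookup (poly_const c * p) m = c * Poly_Mapping.lookup p m"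
  unfolding poly_const_def mult_map_scale_conv_mult[symmetric]
  by (simp add: Poly_Mapping.map.rep_eq when_def)

lemma diff_ops_scalar: "F \<in> diff_ops \<Longrightarrow> F (poly_const c * f) = poly_const c * F f"
proof (induction arbitrary: f rule: diff_ops.induct)
  case (deriv v)
  show ?case
    by (rule poly_mapping_eqI) (simp add: lookup_partial_deriv lookup_poly_const_mult)
qed (simp_all add: mult.left_commute distrib_left)

lemma scalar_op_central: "scalar_op c * F = F * scalar_op c"
proof -
  have "apply_op (scalar_op c * F) f = apply_op (F * scalar_op c) f" for f
    using diff_ops_scalar[OF apply_op, of F c f]
    by (simp add: times_diff_op.rep_eq scalar_op_def apply_mult_op)
  then show ?thesis by (intro apply_op_inject[THEN iffD1] ext)
qed

lemma poly_const_simps: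
  "poly_const (a + b) = poly_const a + poly_const b" "poly_const (a * b) = poly_const a * poly_const b"
  "poly_const 1 = 1" "poly_const (- a) = - poly_const a"
  by (simp_all add: poly_const_def single_add mult_single single_uminus)

lemma mult_op_simps:
  "mult_op (p + q) = mult_op p + mult_op q" "mult_op (p * q) = mult_op p * mult_op q"
  "mult_op 1 = 1" "mult_op (- p) = - mult_op p"
  by (rule apply_op_inject[THEN iffD1], rule ext, simp add: apply_mult_op algebra_simps
      plus_diff_op.rep_eq times_diff_op.rep_eq one_diff_op.rep_eq uminus_diff_op.rep_eq)+

lemma scalar_op_simps:
  "scalar_op (a + b) = scalar_op a + scalar_op b" "scalar_op (a * b) = scalar_op a * scalar_op b"
  "scalar_op 1 = 1" "scalar_op (- a) = - scalar_op a"
  by (simp_all add: scalar_op_def poly_const_simps mult_op_simps)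

lemma scalar_op_of_int: "scalar_op (of_int k) = of_int k"
proof -
  have nat: "scalar_op (of_nat j) = of_nat j" for j
    using scalar_op_simps(1)[of 0 0] by (induction j) (simp_all add: scalar_op_simps)
  show ?thesis
    by (cases k) (simp_all only: of_int_of_nat_eq of_int_minus scalar_op_simps nat)
qed

lemma var_op_commute: "comm (var_op v) (var_op w)"
  by (simp add: comm_def var_op_def mult_op_simps[symmetric] mult.commute)

lemma deriv_op_commute: "comm (deriv_op v) (deriv_op w)"
proof -
  have "partial_deriv v (partial_deriv w p) = partial_deriv w (partial_deriv v p)" for p :: "'a cpoly"
    by (rule poly_mapping_eqI, cases "v = w")
      (simp_all add: lookup_partial_deriv lookup_add lookup_single ac_simps)
  then show ?thesis unfolding comm_def
    by transfer (simp add: fun_eq_iff)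
qed

lemma partial_deriv_single:
  "partial_deriv v (Poly_Mapping.single m c)
     = Poly_Mapping.single (m - Poly_Mapping.single v 1) (of_nat (Poly_Mapping.lookup m v) * c)"
  by (cases "c = 0") (simp_all add: partial_deriv_def)

lemma partial_deriv_poly_var_mult:
  "partial_deriv v (poly_var w * f) = poly_var w * partial_deriv v f + (if v = w then f else 0)"
proof (rule poly_additive_eqI[of "\<lambda>f. partial_deriv v (poly_var w * f)"])
  fix m :: "'a \<Rightarrow>\<^sub>0 nat" and c :: complex
  let ?e = "\<lambda>v. Poly_Mapping.single v (1::nat)"
  show "partial_deriv v (poly_var w * Poly_Mapping.single m c)
     = poly_var w * partial_deriv v (Poly_Mapping.single m c)
       + (if v = w then Poly_Mapping.single m c else 0)"
  proof (cases "v = w")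
    case True
    have "?e v + (m - ?e v) = m" if "Poly_Mapping.lookup m v \<noteq> 0"
      using that by (intro poly_mapping_eqI) (auto simp: lookup_add lookup_minus lookup_single when_def)
    moreover have "?e v + m - ?e v = m" by simp
    ultimately show ?thesis using True
      by (cases "Poly_Mapping.lookup m v = 0")
        (simp_all add: poly_var_def mult_single partial_deriv_single lookup_add lookup_single
          single_add[symmetric] algebra_simps)
  next
    case False
    have "?e w + m - ?e v = ?e w + (m - ?e v)"
      using False by (intro poly_mapping_eqI) (auto simp: lookup_add lookup_minus lookup_single when_def)
    then show ?thesis using False
      by (simp add: poly_var_def mult_single partial_deriv_single lookup_add lookup_single)
  qed
qed (auto simp: partial_deriv_add algebra_simps)

lemma deriv_op_var_op:
  "deriv_op v * var_op w = var_op w * deriv_op v + (if v = w then 1 else 0)"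
proof -
  have "apply_op (deriv_op v * var_op w) f
      = apply_op (var_op w * deriv_op v + (if v = w then 1 else 0)) f" for f
    by (simp add: var_op_def times_diff_op.rep_eq plus_diff_op.rep_eq apply_mult_op
      deriv_op.rep_eq partial_deriv_poly_var_mult one_diff_op.rep_eq zero_diff_op.rep_eq)
  then show ?thesis by (intro apply_op_inject[THEN iffD1] ext)
qed


section \<open>The decomplexified Capelli identity\<close>

lemma emb_rform: "emb (rform R J i j) = rform (\<lambda>a b. emb (R a b)) (\<lambda>a b. emb (J a b)) i j"
  by (simp add: rform_def emb_uminus)

lemma emb_tform: "emb (tform n q I i j) = tform n (emb q) (emb I) i j"
  by (simp add: tform_def emb_0 emb_add emb_diff emb_mult emb_of_int del: of_int_diff of_int_add)

text \<open>
  The variables are numbered from \<open>1\<close>, the arrays from \<open>0\<close>.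
\<close>

lemma cdet_real_capelli:
  fixes x y :: "nat \<Rightarrow> nat \<Rightarrow> 'v"
  assumes x: "inj_on (\<lambda>(a, b). x a b) ({1..n} \<times> {1..n})"
    and y: "inj_on (\<lambda>(a, b). y a b) ({1..n} \<times> {1..n})"
    and xy: "(\<lambda>(a, b). x a b) ` ({1..n} \<times> {1..n}) \<inter> (\<lambda>(a, b). y a b) ` ({1..n} \<times> {1..n}) = {}"
    and s: "s * s = - 1"
  defines "X \<equiv> \<lambda>a b. var_op (x (Suc a) (Suc b))" and "Y \<equiv> \<lambda>a b. var_op (y (Suc a) (Suc b))"
    and "U \<equiv> \<lambda>a b. scalar_op (1/2) * deriv_op (x (Suc b) (Suc a))"
    and "V \<equiv> \<lambda>a b. - (scalar_op (1/2) * deriv_op (y (Suc b) (Suc a)))"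
  shows "cdet (2 * n) (\<lambda>i j. (\<Sum>l<2 * n. rform X Y i l * rform U V l j)
      + tform n (scalar_op (1/4)) (scalar_op s) i j)
    = cdet (2 * n) (rform X Y) * cdet (2 * n) (rform U V)"
proof -
  have xx: "x (Suc a) (Suc b) = x (Suc c) (Suc d) \<longleftrightarrow> a = c \<and> b = d"
    if "a < n" "b < n" "c < n" "d < n" for a b c d
    using inj_onD[OF x, of "(Suc a, Suc b)" "(Suc c, Suc d)"] that by auto
  have yy: "y (Suc a) (Suc b) = y (Suc c) (Suc d) \<longleftrightarrow> a = c \<and> b = d"
    if "a < n" "b < n" "c < n" "d < n" for a b c d
    using inj_onD[OF y, of "(Suc a, Suc b)" "(Suc c, Suc d)"] that by auto
  have xny: "x (Suc a) (Suc b) \<noteq> y (Suc c) (Suc d)" if "a < n" "b < n" "c < n" "d < n" for a b c d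
  proof -
    have "x (Suc a) (Suc b) \<in> (\<lambda>(a, b). x a b) ` ({1..n} \<times> {1..n})"
      using that by (intro image_eqI[of _ _ "(Suc a, Suc b)"]) auto
    moreover have "y (Suc c) (Suc d) \<in> (\<lambda>(a, b). y a b) ` ({1..n} \<times> {1..n})"
      using that by (intro image_eqI[of _ _ "(Suc c, Suc d)"]) auto
    ultimately show ?thesis using xy by (metis disjoint_iff)
  qed
  have sc: "comm w (scalar_op c)" for w :: "'v diff_op" and c
    by (simp add: comm_def scalar_op_central)
  have dv: "scalar_op c * deriv_op v * var_op w
      = var_op w * (scalar_op c * deriv_op v) + (if v = w then scalar_op c else 0)"
    for c and v w :: 'v
    by (simp add: mult.assoc deriv_op_var_op distrib_left mult_left_commute_central[OF comm_sym[OF sc]])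
  interpret real_capelli n "emb (scalar_op s)" "emb (scalar_op (1/2))" create
    "\<lambda>a b. emb (X a b)" "\<lambda>a b. emb (Y a b)" "\<lambda>a b. emb (U a b)" "\<lambda>a b. emb (V a b)"
  proof
    show "comm (emb (scalar_op s)) w" "comm (emb (scalar_op (1/2))) w" for w :: "'v diff_op fock"
      by (intro comm_emb_central scalar_op_central)+
    show "emb (scalar_op s) * emb (scalar_op s) = - (1 :: 'v diff_op fock)"
      by (simp add: emb_mult[symmetric] scalar_op_simps(2)[symmetric] s)
        (simp add: scalar_op_simps emb_uminus emb_1)
    show "emb (scalar_op (1/2)) + emb (scalar_op (1/2)) = (1 :: 'v diff_op fock)"
      by (simp add: emb_add[symmetric] scalar_op_simps(1)[symmetric])
        (simp add: scalar_op_simps emb_1)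
  next
    fix a b c d assume ix: "a < n" "b < n" "c < n" "d < n"
    show "comm (emb (U a b)) (emb (Y c d))"
      using xny[OF ix(2,1,3,4)] by (intro comm_emb) (simp add: comm_def U_def Y_def dv)
    show "comm (emb (V a b)) (emb (X c d))"
      using xny[OF ix(3,4,2,1)] by (intro comm_emb comm_sym[of "V _ _"])
        (auto simp: comm_def V_def X_def dv)
    show "emb (U c b) * emb (X a d) = emb (X a d) * emb (U c b)
        + (if a = b \<and> c = d then emb (scalar_op (1/2)) else 0)"
      using xx[OF ix(2,3,1,4)]
      by (auto simp: emb_mult[symmetric] emb_add[symmetric] U_def X_def dv)
    show "emb (V c b) * emb (Y a d) = emb (Y a d) * emb (V c b)
        - (if a = b \<and> c = d then emb (scalar_op (1/2)) else 0)"
      using yy[OF ix(2,3,1,4)]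
      by (auto simp: emb_mult[symmetric] emb_diff[symmetric] V_def Y_def dv)
  qed (auto simp: X_def Y_def U_def V_def intro!: anticommuting_create comm_create_emb comm_emb
      comm_mult_left comm_mult comm_uminus sc comm_sym[OF sc] var_op_commute deriv_op_commute
      comm_sym[OF comm_uminus])
  have q: "emb (scalar_op (1/2)) * emb (scalar_op (1/2)) = (emb (scalar_op (1/4)) :: 'v diff_op fock)"
    by (simp add: emb_mult[symmetric] scalar_op_simps(2)[symmetric])
  show ?thesis
    by (rule oprod_create_cancel[of "2 * n"])
      (simp only: emb_cdet emb_add emb_sum emb_mult emb_rform emb_tform real_capelli_identity[unfolded q])
qed

lemma col_det_eq_cdet:
  "dim_col M = N \<Longrightarrow> col_det M = cdet N (\<lambda>i j. M $$ (i, j))"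
  by (simp add: col_det_def cdet_def oprod_def)

lemma cdet_cong: "(\<And>i j. i < N \<Longrightarrow> j < N \<Longrightarrow> M i j = M' i j) \<Longrightarrow> cdet N M = cdet N M'"
  unfolding cdet_def
  by (intro sum.cong refl arg_cong2[of _ _ _ _ "(*)"] oprod_cong) (auto dest: permutes_in_image)

lemma real_form_index:
  assumes "i < 2 * n" "j < 2 * n"
  shows "real_form n R J $$ (i, j) = rform (\<lambda>a b. R (Suc a) (Suc b)) (\<lambda>a b. J (Suc a) (Suc b)) i j"
  using assms
  by (cases "even i"; cases "even j")
    (simp_all add: real_form_def block2_mat_def rform_def mat_of_rows_list_def even_iff_mod_2_eq_zero odd_iff_mod_2_eq_one)

lemma T_index:
  assumes "i < 2 * n" "j < 2 * n"
  shows "scalar_op (T_mat n $$ (i, j)) = tform n (scalar_op (1/4)) (scalar_op \<i>) i j"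
    and "scalar_op (cnj (T_mat n $$ (i, j))) = tform n (scalar_op (1/4)) (scalar_op (- \<i>)) i j"
proof -
  have k: "of_nat n - of_nat (i div 2 + 1) = (of_int (int n - 1 - int (i div 2)) :: complex)" by simp
  have e: "T_mat n $$ (i, j) = (if i div 2 \<noteq> j div 2 then 0
     else if even i then if even j then of_int (int n - 1 - int (i div 2)) + 1/4 else \<i> * (1/4)
     else if even j then \<i> * (1/4) else of_int (int n - 1 - int (i div 2)) + - (1/4))"
    unfolding k[symmetric] using assms
    by (cases "even i"; cases "even j")
      (auto simp: T_mat_def block2_mat_def mat_of_rows_list_def even_iff_mod_2_eq_zero odd_iff_mod_2_eq_one)
  have 0: "scalar_op 0 = 0" using scalar_op_simps(1)[of 0 0] by simp
  have cnj: "cnj (T_mat n $$ (i, j)) = (if i div 2 \<noteq> j div 2 then 0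
     else if even i then if even j then of_int (int n - 1 - int (i div 2)) + 1/4 else - \<i> * (1/4)
     else if even j then - \<i> * (1/4) else of_int (int n - 1 - int (i div 2)) + - (1/4))"
    unfolding e by simp
  note scalar = if_distrib[of scalar_op] 0 scalar_op_of_int scalar_op_simps(1,2,4) diff_conv_add_uminus
  show "scalar_op (T_mat n $$ (i, j)) = tform n (scalar_op (1/4)) (scalar_op \<i>) i j"
    unfolding e tform_def by (simp only: scalar)
  show "scalar_op (cnj (T_mat n $$ (i, j))) = tform n (scalar_op (1/4)) (scalar_op (- \<i>)) i j"
    unfolding cnj tform_def by (simp only: scalar)
qed

theorem theorem4:
  fixes n :: nat and x y :: "nat \<Rightarrow> nat \<Rightarrow> 'v"
  assumes "inj_on (\<lambda>(a, b). x a b) ({1..n} \<times> {1..n})"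
    and "inj_on (\<lambda>(a, b). y a b) ({1..n} \<times> {1..n})"
    and "(\<lambda>(a, b). x a b) ` ({1..n} \<times> {1..n}) \<inter> (\<lambda>(a, b). y a b) ` ({1..n} \<times> {1..n}) = {}"
    and "(\<lambda>(a, b). x a b) ` ({1..n} \<times> {1..n}) \<union> (\<lambda>(a, b). y a b) ` ({1..n} \<times> {1..n}) = UNIV"
  shows "col_det (Z_real n x y * Dt_real n x y + map_mat scalar_op (T_mat n))
           = col_det (Z_real n x y) * col_det (Dt_real n x y)
       \<and> col_det (Z_real n x y * Dt_real n x y + map_mat scalar_op (map_mat cnj (T_mat n)))
           = col_det (Z_real n x y) * col_det (Dt_real n x y)"
proof -
  let ?X = "\<lambda>a b. var_op (x (Suc a) (Suc b))" and ?Y = "\<lambda>a b. var_op (y (Suc a) (Suc b))"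
  let ?U = "\<lambda>a b. scalar_op (1/2) * deriv_op (x (Suc b) (Suc a))"
  let ?V = "\<lambda>a b. - (scalar_op (1/2) * deriv_op (y (Suc b) (Suc a)))"
  have dims [simp]: "dim_row (Z_real n x y) = 2 * n" "dim_col (Z_real n x y) = 2 * n"
    "dim_row (Dt_real n x y) = 2 * n" "dim_col (Dt_real n x y) = 2 * n"
    "dim_row (T_mat n) = 2 * n" "dim_col (T_mat n) = 2 * n"
    by (simp_all add: Z_real_def Dt_real_def real_form_def T_mat_def block2_mat_def)
  have Z: "Z_real n x y $$ (i, j) = rform ?X ?Y i j" if "i < 2 * n" "j < 2 * n" for i j
    unfolding Z_real_def using that by (rule real_form_index)
  have D: "Dt_real n x y $$ (i, j) = rform ?U ?V i j" if "i < 2 * n" "j < 2 * n" for i j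
    unfolding Dt_real_def using that by (rule real_form_index)
  have "col_det (Z_real n x y * Dt_real n x y + map_mat scalar_op M)
      = col_det (Z_real n x y) * col_det (Dt_real n x y)"
    if M: "dim_row M = 2 * n" "dim_col M = 2 * n" and s: "s * s = - 1"
      and T: "\<And>i j. i < 2 * n \<Longrightarrow> j < 2 * n \<Longrightarrow>
        (scalar_op (M $$ (i, j)) :: 'v diff_op) = tform n (scalar_op (1/4)) (scalar_op s) i j" for M s
  proof -
    have "col_det (Z_real n x y * Dt_real n x y + map_mat scalar_op M)
      = cdet (2 * n) (\<lambda>i j. (Z_real n x y * Dt_real n x y + map_mat scalar_op M) $$ (i, j))"
      by (rule col_det_eq_cdet) (simp add: M)
    also have "\<dots> = cdet (2 * n) (\<lambda>i j. (\<Sum>l<2 * n. rform ?X ?Y i l * rform ?U ?V l j)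
      + tform n (scalar_op (1/4)) (scalar_op s) i j)"
      by (rule cdet_cong) (simp add: M T Z D scalar_prod_def lessThan_atLeast0)
    also have "\<dots> = cdet (2 * n) (rform ?X ?Y) * cdet (2 * n) (rform ?U ?V)"
      by (rule cdet_real_capelli[OF assms(1-3) s])
    also have "cdet (2 * n) (rform ?X ?Y) = col_det (Z_real n x y)"
      by (subst col_det_eq_cdet[of _ "2 * n"]) (auto simp: Z intro: cdet_cong)
    also have "cdet (2 * n) (rform ?U ?V) = col_det (Dt_real n x y)"
      by (subst col_det_eq_cdet[of _ "2 * n"]) (auto simp: D intro: cdet_cong)
    finally show ?thesis .
  qed
  from this[of "T_mat n" "\<i>"] this[of "map_mat cnj (T_mat n)" "- \<i>"]
  show ?thesis by (simp add: T_index)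
qed

end
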